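(* Let ${\mathscr A}$ be a nonzero $C^*$-algebra, and $a, b\in {\mathscr A}$. Then the following statements are equivalent: (i) $a\parallel b$; (ii) there exist a state $\varphi$ over $\mathscr A$ and $\lambda\in\mathbb{T}$ such that $\varphi(a^*b)=\lambda\|a\|\|b\|$; (iii) there exist a Hilbert space $\mathscr{H}$, a representation $\pi:{\mathscr A}\to \mathbb{B}(\mathscr{H})$, a unit vector $\xi\in \mathscr{H}$ and $\lambda\in\mathbb{T}$ such that $\|\pi(a)\xi\|=\|a\|$ and $(\pi(a)\xi\mid \pi(b)\xi)=\lambda\|a\|\|b\|$.
   Context: $C^*$-algebras are complex and not assumed unital. A state over $\mathscr A$ is a linear functional $\varphi$ of norm one with $\varphi(a)\ge 0$ for every positive $a\in\mathscr A$. A representation is a $*$-homomorphism into the algebra $\mathbb{B}(\mathscr{H})$ of bounded operators on a complex Hilbert space $\mathscr{H}$ with inner product $(\cdot\mid\cdot)$. $\mathbb{T}=\{\alpha\in\mathbb{C}:|\alpha|=1\}$. For elements $x,y$ of a normed space, $x\parallel y$ means that $\|x+\lambda y\|=\|x\|+\|y\|$ for some $\lambda\in\mathbb{T}$. *)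

theory Defs
  imports "HOL-Analysis.Analysis" "HOL-Algebra.Module"
begin

section \<open>Complex normed spaces and norm parallelism\<close>

class complex_normed_vector = real_normed_vector +
  fixes scaleC :: "complex \<Rightarrow> 'a \<Rightarrow> 'a"  (infixr \<open>*\<^sub>C\<close> 75)
  assumes scaleC_add_right: "c *\<^sub>C (x + y) = c *\<^sub>C x + c *\<^sub>C y"
    and scaleC_add_left: "(c + d) *\<^sub>C x = c *\<^sub>C x + d *\<^sub>C x"
    and scaleC_scaleC: "c *\<^sub>C (d *\<^sub>C x) = (c * d) *\<^sub>C x"
    and scaleR_scaleC: "r *\<^sub>R x = complex_of_real r *\<^sub>C x"
    and norm_scaleC: "norm (c *\<^sub>C x) = cmod c * norm x"

definition norm_parallel :: "'a::complex_normed_vector \<Rightarrow> 'a \<Rightarrow> bool" where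
  "norm_parallel x y \<longleftrightarrow> (\<exists>\<alpha>. cmod \<alpha> = 1 \<and> norm (x + \<alpha> *\<^sub>C y) = norm x + norm y)"


section \<open>C*-algebras and states\<close>

text \<open>The class \<^class>\<open>real_normed_algebra\<close> supplies an associative, not necessarily unital
  (and possibly zero) algebra with a submultiplicative norm.\<close>

class cstar_algebra = complex_normed_vector + real_normed_algebra + banach +
  fixes star :: "'a \<Rightarrow> 'a"  (\<open>(_\<^sup>\<star>)\<close> [1000] 999)
  assumes mult_scaleC_left: "(c *\<^sub>C x) * y = c *\<^sub>C (x * y)"
    and mult_scaleC_right: "x * (c *\<^sub>C y) = c *\<^sub>C (x * y)"
    and star_star: "(x\<^sup>\<star>)\<^sup>\<star> = x"
    and star_add: "(x + y)\<^sup>\<star> = x\<^sup>\<star> + y\<^sup>\<star>"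
    and star_scaleC: "(c *\<^sub>C x)\<^sup>\<star> = cnj c *\<^sub>C x\<^sup>\<star>"
    and star_mult: "(x * y)\<^sup>\<star> = y\<^sup>\<star> * x\<^sup>\<star>"
    and cstar_identity: "norm (x\<^sup>\<star> * x) = (norm x)\<^sup>2"

definition positive :: "'a::cstar_algebra \<Rightarrow> bool" where
  "positive a \<longleftrightarrow> (\<exists>x. a = x\<^sup>\<star> * x)"

text \<open>Boundedness has to be required explicitly: \<^const>\<open>onorm\<close> is an unspecified real number
  on unbounded maps.\<close>

definition state :: "('a::cstar_algebra \<Rightarrow> complex) \<Rightarrow> bool" where
  "state \<phi> \<longleftrightarrow>
     bounded_linear \<phi> \<and> (\<forall>c x. \<phi> (c *\<^sub>C x) = c * \<phi> x) \<and>
     onorm \<phi> = 1 \<and>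
     (\<forall>a. positive a \<longrightarrow> \<phi> a \<in> \<real>\<^sub>\<ge>\<^sub>0)"


section \<open>Hilbert spaces and representations\<close>

text \<open>Hilbert spaces are structures with an explicit carrier, so that they can be existentially
  quantified. The ring operations \<open>mult\<close> and \<open>one\<close> inherited from the record
  \<^typ>\<open>('a, 'b) module\<close> play no role.\<close>

definition complex_ring :: "complex ring" where
  "complex_ring = \<lparr>carrier = UNIV, mult = (*), one = 1, zero = 0, add = (+)\<rparr>"

record 'h hilbert = "(complex, 'h) module" +
  cinner :: "'h \<Rightarrow> 'h \<Rightarrow> complex"

definition hnorm :: "'h hilbert \<Rightarrow> 'h \<Rightarrow> real" where
  "hnorm H x = sqrt (Re (cinner H x x))"

definition hdist :: "'h hilbert \<Rightarrow> 'h \<Rightarrow> 'h \<Rightarrow> real" where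
  "hdist H x y = hnorm H (x \<ominus>\<^bsub>H\<^esub> y)"

text \<open>The inner product is linear in its second argument.\<close>

locale hilbert_space = Module.module complex_ring H for H :: "'h hilbert" (structure) +
  assumes cinner_add_right:
      "\<lbrakk>x \<in> carrier H; y \<in> carrier H; z \<in> carrier H\<rbrakk>
        \<Longrightarrow> cinner H x (y \<oplus> z) = cinner H x y + cinner H x z"
    and cinner_smult_right:
      "\<lbrakk>x \<in> carrier H; y \<in> carrier H\<rbrakk> \<Longrightarrow> cinner H x (c \<odot>\<^bsub>H\<^esub> y) = c * cinner H x y"
    and cinner_commute:
      "\<lbrakk>x \<in> carrier H; y \<in> carrier H\<rbrakk> \<Longrightarrow> cinner H x y = cnj (cinner H y x)"
    and cinner_nonneg: "x \<in> carrier H \<Longrightarrow> cinner H x x \<in> \<real>\<^sub>\<ge>\<^sub>0"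
    and cinner_eq_zero: "\<lbrakk>x \<in> carrier H; cinner H x x = 0\<rbrakk> \<Longrightarrow> x = \<zero>\<^bsub>H\<^esub>"
    and complete: "Metric_space.mcomplete (carrier H) (hdist H)"

text \<open>Operators are functions on the whole type of which only the restriction to the carrier
  is relevant.\<close>

definition bounded_operators :: "'h hilbert \<Rightarrow> ('h \<Rightarrow> 'h) set" where
  "bounded_operators H = {T \<in> carrier H \<rightarrow> carrier H.
     (\<forall>x\<in>carrier H. \<forall>y\<in>carrier H. T (x \<oplus>\<^bsub>H\<^esub> y) = T x \<oplus>\<^bsub>H\<^esub> T y) \<and>
     (\<forall>c. \<forall>x\<in>carrier H. T (c \<odot>\<^bsub>H\<^esub> x) = c \<odot>\<^bsub>H\<^esub> T x) \<and>
     (\<exists>K. \<forall>x\<in>carrier H. hnorm H (T x) \<le> K * hnorm H x)}"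

definition adjoint_of :: "'h hilbert \<Rightarrow> ('h \<Rightarrow> 'h) \<Rightarrow> ('h \<Rightarrow> 'h) \<Rightarrow> bool" where
  "adjoint_of H S T \<longleftrightarrow>
     (\<forall>x\<in>carrier H. \<forall>y\<in>carrier H. cinner H (S x) y = cinner H x (T y))"

definition representation ::
    "'h hilbert \<Rightarrow> ('a::cstar_algebra \<Rightarrow> 'h \<Rightarrow> 'h) \<Rightarrow> bool" where
  "representation H \<pi> \<longleftrightarrow>
     (\<forall>a. \<pi> a \<in> bounded_operators H) \<and>
     (\<forall>a b. \<forall>x\<in>carrier H. \<pi> (a + b) x = \<pi> a x \<oplus>\<^bsub>H\<^esub> \<pi> b x) \<and>
     (\<forall>c a. \<forall>x\<in>carrier H. \<pi> (c *\<^sub>C a) x = c \<odot>\<^bsub>H\<^esub> \<pi> a x) \<and>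
     (\<forall>a b. \<forall>x\<in>carrier H. \<pi> (a * b) x = \<pi> a (\<pi> b x)) \<and>
     (\<forall>a. adjoint_of H (\<pi> (a\<^sup>\<star>)) (\<pi> a))"

text \<open>HOL has no quantification over types, so ``there exists a Hilbert space'' needs a fixed
  element type. For the existence direction, \<open>'a \<Rightarrow> complex\<close> suffices for an algebra \<open>'a\<close>:
  a Hilbert space with a vector \<open>\<xi>\<close> cyclic for a representation \<open>\<pi>\<close> embeds into it by sending
  \<open>\<eta>\<close> to the function \<open>\<lambda>x. (\<pi> x \<xi> | \<eta>)\<close>. For the converse direction, the element type is a free
  type variable.\<close>

definition parallel_in_representation ::
    "'h hilbert \<Rightarrow> 'a::cstar_algebra \<Rightarrow> 'a \<Rightarrow> bool" where
  "parallel_in_representation H a b \<longleftrightarrow>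
     (\<exists>\<pi> \<xi> \<alpha>. representation H \<pi> \<and> \<xi> \<in> carrier H \<and> hnorm H \<xi> = 1 \<and> cmod \<alpha> = 1 \<and>
        hnorm H (\<pi> a \<xi>) = norm a \<and>
        cinner H (\<pi> a \<xi>) (\<pi> b \<xi>) = \<alpha> * of_real (norm a * norm b))"

end

theory Submission
  imports Defs
begin

text \<open>
  Parallelism is trivial if \<open>a\<close> or \<open>b\<close> is zero. Otherwise, if a state \<open>\<phi>\<close> satisfies (ii), the
  Cauchy-Schwarz inequality for the form
  \<open>(x, y) \<mapsto> \<phi> (x\<^sup>\<star> y)\<close> and \<open>\<phi> (x\<^sup>\<star> x) \<le> \<parallel>x\<parallel>\<^sup>2\<close> give \<open>\<phi> (a\<^sup>\<star> a) = \<parallel>a\<parallel>\<^sup>2\<close> and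
  \<open>\<phi> (b\<^sup>\<star> b) = \<parallel>b\<parallel>\<^sup>2\<close>, so that \<open>\<phi>\<close> takes the value \<open>(\<parallel>a\<parallel> + \<parallel>b\<parallel>)\<^sup>2\<close> at
  \<open>(a + \<alpha> b)\<^sup>\<star> (a + \<alpha> b)\<close> for a suitable \<open>\<alpha>\<close> (\<open>norm_parallel_if_extremal\<close>). A vector state of a
  representation is treated in the same way (\<open>norm_parallel_if_representation\<close>).

  Conversely, let \<open>c = a + \<alpha> b\<close> with \<open>\<parallel>c\<parallel> = \<parallel>a\<parallel> + \<parallel>b\<parallel>\<close>, and let \<open>\<phi>\<close> be a state with
  \<open>\<phi> (c\<^sup>\<star> c) = \<parallel>c\<parallel>\<^sup>2\<close>. Equality in the triangle inequality for the seminorm of \<open>\<phi>\<close> then yields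
  (ii) together with \<open>\<phi> (a\<^sup>\<star> a) = \<parallel>a\<parallel>\<^sup>2\<close> (\<open>extremal_if_snorm_attained\<close>), and (iii) is the GNS
  representation of \<open>\<phi>\<close> (\<open>representation_gns\<close>), built on a completion whose vectors are functions
  on the algebra (\<open>hilbert_space_completion\<close>). Its unit vector is the class of
  \<open>c\<^sup>\<star> c / \<parallel>c\<parallel>\<^sup>2\<close>, which equals the class of the unit (\<open>exists_unit_mod_kernel\<close>).

  The main work is the existence of a state that attains the norm at \<open>c\<^sup>\<star> c\<close>
  (\<open>exists_norming_positive_functional\<close>). By the Hahn-Banach theorem
  (\<open>exists_linear_dominated\<close>) for the distance to the negative of the positive cone, it suffices
  that the norm is monotone on the cone (\<open>psd_norm_mono\<close>) and that every \<open>x\<^sup>\<star> x\<close> lies in the cone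
  of squares of hermitian elements (\<open>psd_star_mult\<close>). The theory of this cone is developed in an
  algebra with unit and without the spectrum. Its only analytic ingredient is the square root
  of \<open>1 - h\<close> for a hermitian \<open>h\<close> of norm at most one (\<open>exists_one_minus_sqrt\<close>), which makes every
  hermitian contraction the real part of a unitary and thereby describes the cone by norm
  inequalities (\<open>norm_half_minus_psd\<close>, \<open>psd_iff\<close>). A unit is adjoined to reach the general case.
\<close>

section \<open>Elementary facts on complex normed spaces and C*-algebras\<close>

lemma scaleC_of_real: "complex_of_real r *\<^sub>C x = r *\<^sub>R x"
  for x :: "'a::complex_normed_vector"
  by (simp add: scaleR_scaleC)

lemma scaleC_zero_left [simp]: "0 *\<^sub>C x = 0" for x :: "'a::complex_normed_vector"
  using scaleC_of_real[of 0 x] by simp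

lemma scaleC_one [simp]: "1 *\<^sub>C x = x" for x :: "'a::complex_normed_vector"
  using scaleC_of_real[of 1 x] by simp

lemma scaleC_zero_right [simp]: "c *\<^sub>C (0::'a::complex_normed_vector) = 0"
  using norm_scaleC[of c "0::'a"] by simp

lemma scaleC_minus_left [simp]: "(- c) *\<^sub>C x = - (c *\<^sub>C x)"
  for x :: "'a::complex_normed_vector"
  using scaleC_add_left[of "- c" c x] by (simp add: eq_neg_iff_add_eq_0)

lemma scaleC_minus_right [simp]: "c *\<^sub>C (- x) = - (c *\<^sub>C x)"
  for x :: "'a::complex_normed_vector"
  using scaleC_add_right[of c "- x" x] by (simp add: eq_neg_iff_add_eq_0)

lemma scaleC_diff_right: "c *\<^sub>C (x - y) = c *\<^sub>C x - c *\<^sub>C y"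
  for x :: "'a::complex_normed_vector"
  using scaleC_add_right[of c x "- y"] by simp

lemma scaleC_scaleR: "c *\<^sub>C (r *\<^sub>R x) = r *\<^sub>R (c *\<^sub>C x)"
  for x :: "'a::complex_normed_vector"
  by (simp add: scaleR_scaleC scaleC_scaleC mult.commute)

lemma star_zero [simp]: "(0::'a::cstar_algebra)\<^sup>\<star> = 0"
  using star_add[of "0::'a" 0] by simp

lemma star_minus [simp]: "(- x)\<^sup>\<star> = - (x\<^sup>\<star>)" for x :: "'a::cstar_algebra"
  using star_add[of "- x" x] by (simp add: eq_neg_iff_add_eq_0)

lemma star_diff: "(x - y)\<^sup>\<star> = x\<^sup>\<star> - y\<^sup>\<star>" for x :: "'a::cstar_algebra"
  using star_add[of x "- y"] by simp

lemma star_scaleR [simp]: "(r *\<^sub>R x)\<^sup>\<star> = r *\<^sub>R x\<^sup>\<star>" for x :: "'a::cstar_algebra"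
  by (simp add: scaleR_scaleC star_scaleC)

lemma norm_star [simp]: "norm (x\<^sup>\<star>) = norm x" for x :: "'a::cstar_algebra"
proof -
  have le: "norm y \<le> norm (y\<^sup>\<star>)" for y :: 'a
  proof (cases "y = 0")
    case False
    have "norm y * norm y = norm (y\<^sup>\<star> * y)"
      by (simp add: cstar_identity power2_eq_square)
    also have "\<dots> \<le> norm (y\<^sup>\<star>) * norm y"
      by (rule norm_mult_ineq)
    finally show ?thesis
      using False by simp
  qed simp
  from le[of x] le[of "x\<^sup>\<star>"] show ?thesis
    by (simp add: star_star)
qed

lemma bounded_linear_star: "bounded_linear (star :: 'a::cstar_algebra \<Rightarrow> 'a)"
  by (rule bounded_linear_intro[where K = 1]) (simp_all add: star_add)

lemmas tendsto_star = bounded_linear.tendsto[OF bounded_linear_star]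

lemma norm_hermitian_square: "x\<^sup>\<star> = x \<Longrightarrow> norm (x * x) = (norm x)\<^sup>2"
  for x :: "'a::cstar_algebra"
  using cstar_identity[of x] by simp

section \<open>Square roots by iteration\<close>

text \<open>In an algebra with unit the solution \<open>y\<close> below is \<open>1 - sqrt (1 - h)\<close>; written as
  \<open>2y - y\<^sup>2 = h\<close> the equation makes sense without a unit. The iteration
  \<open>y \<mapsto> (h + y\<^sup>2) / 2\<close> started at \<open>0\<close> converges even for \<open>norm h = 1\<close>, although it is no
  contraction then: its increments are bounded by those of the real iteration
  \<open>t \<mapsto> (1 + t\<^sup>2) / 2\<close>, which increases and stays below \<open>1\<close>.\<close>

primrec sqrt_iter :: "'a::{plus,times,zero,scaleR} \<Rightarrow> nat \<Rightarrow> 'a" where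
  "sqrt_iter h 0 = 0"
| "sqrt_iter h (Suc n) = (1 / 2) *\<^sub>R (h + sqrt_iter h n * sqrt_iter h n)"

lemma sqrt_iter_real: "0 \<le> sqrt_iter (1::real) n \<and> sqrt_iter (1::real) n \<le> 1"
proof (induction n)
  case (Suc n)
  then have "sqrt_iter (1::real) n * sqrt_iter 1 n \<le> 1"
    by (intro mult_le_one) auto
  then show ?case
    by (simp add: zero_le_mult_iff)
qed simp

lemma sqrt_iter_increment:
  fixes h :: "'a::real_normed_algebra"
  shows "sqrt_iter h (Suc (Suc n)) - sqrt_iter h (Suc n) = (1 / 2) *\<^sub>R
    (sqrt_iter h (Suc n) * (sqrt_iter h (Suc n) - sqrt_iter h n)
      + (sqrt_iter h (Suc n) - sqrt_iter h n) * sqrt_iter h n)"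
proof -
  have "sqrt_iter h (Suc (Suc n)) - sqrt_iter h (Suc n)
      = (1 / 2) *\<^sub>R (h + sqrt_iter h (Suc n) * sqrt_iter h (Suc n))
        - (1 / 2) *\<^sub>R (h + sqrt_iter h n * sqrt_iter h n)"
    by (simp only: sqrt_iter.simps)
  then show ?thesis
    by (simp add: algebra_simps del: sqrt_iter.simps)
qed

lemma sqrt_iter_bounds:
  fixes h :: "'a::real_normed_algebra"
  assumes "norm h \<le> 1"
  shows "norm (sqrt_iter h n) \<le> sqrt_iter 1 n"
    and "norm (sqrt_iter h (Suc n) - sqrt_iter h n) \<le> sqrt_iter 1 (Suc n) - sqrt_iter 1 n"
proof -
  let ?y = "sqrt_iter h" and ?t = "sqrt_iter (1::real)"
  show bound: "norm (?y n) \<le> ?t n" for n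
  proof (induction n)
    case (Suc n)
    have "norm (?y n * ?y n) \<le> ?t n * ?t n"
      by (rule order_trans[OF norm_mult_ineq]) (intro mult_mono Suc norm_ge_zero order_trans[OF _ Suc])
    then have "norm (h + ?y n * ?y n) \<le> 1 + ?t n * ?t n"
      using assms norm_triangle_ineq[of h "?y n * ?y n"] by linarith
    then show ?case
      by simp
  qed simp
  show "norm (?y (Suc n) - ?y n) \<le> ?t (Suc n) - ?t n"
  proof (induction n)
    case 0
    then show ?case using assms by simp
  next
    case (Suc n)
    let ?d = "?y (Suc n) - ?y n"
    have "norm (?y (Suc n) * ?d + ?d * ?y n)
        \<le> ?t (Suc n) * (?t (Suc n) - ?t n) + (?t (Suc n) - ?t n) * ?t n"
      using order_trans[OF norm_ge_zero Suc] Suc bound[of n] bound[of "Suc n"] sqrt_iter_real[of n] sqrt_iter_real[of "Suc n"]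
      by (intro norm_triangle_le add_mono order_trans[OF norm_mult_ineq] mult_mono)
        (auto simp del: sqrt_iter.simps intro: order_trans[OF norm_ge_zero])
    then show ?case
      by (simp only: sqrt_iter_increment) simp
  qed
qed

lemma convergent_sqrt_iter:
  fixes h :: "'a::{real_normed_algebra,banach}"
  assumes "norm h \<le> 1"
  shows "convergent (sqrt_iter h)"
proof -
  have incr: "0 \<le> sqrt_iter (1::real) (Suc n) - sqrt_iter 1 n" for n
    by (rule order_trans[OF norm_ge_zero sqrt_iter_bounds(2)[OF assms]])
  then have "incseq (sqrt_iter (1::real))"
    by (intro incseq_SucI) (simp del: sqrt_iter.simps)
  moreover have "\<And>n. sqrt_iter (1::real) n \<le> 1"
    using sqrt_iter_real by blast
  ultimately obtain l where "sqrt_iter (1::real) \<longlonglongrightarrow> l"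
    using incseq_convergent by blast
  then have "summable (\<lambda>n. sqrt_iter (1::real) (Suc n) - sqrt_iter 1 n)"
    using telescope_sums sums_summable by blast
  then have "summable (\<lambda>n. sqrt_iter h (Suc n) - sqrt_iter h n)"
    by (rule summable_comparison_test'[where N = 0]) (use sqrt_iter_bounds(2)[OF assms] in blast)
  then have "convergent (\<lambda>n. \<Sum>i<n. sqrt_iter h (Suc i) - sqrt_iter h i)"
    by (simp only: summable_iff_convergent)
  then show ?thesis
    by (simp only: sum_lessThan_telescope) simp
qed

lemma exists_one_minus_sqrt:
  fixes h :: "'a::cstar_algebra"
  assumes norm_h: "norm h \<le> 1" and herm_h: "h\<^sup>\<star> = h"
  obtains y where "y\<^sup>\<star> = y" "norm y \<le> 1" "2 *\<^sub>R y - y * y = h"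
    "\<And>z. z * h = h * z \<Longrightarrow> z * y = y * z"
proof -
  from convergent_sqrt_iter[OF norm_h] obtain y where lim: "sqrt_iter h \<longlonglongrightarrow> y"
    by (auto simp: convergent_def)
  have "norm (sqrt_iter h n) \<le> 1" for n
    using sqrt_iter_bounds(1)[OF norm_h] sqrt_iter_real order_trans by blast
  then have "norm y \<le> 1"
    using LIMSEQ_le_const2[OF tendsto_norm[OF lim]] by blast
  moreover have "y\<^sup>\<star> = y"
  proof -
    have "(sqrt_iter h n)\<^sup>\<star> = sqrt_iter h n" for n
      by (induction n) (simp_all add: star_add star_mult herm_h)
    then show ?thesis
      using LIMSEQ_unique[OF tendsto_star[OF lim]] lim by simp
  qed
  moreover have "2 *\<^sub>R y - y * y = h"
  proof -
    have "(\<lambda>n. sqrt_iter h (Suc n)) \<longlonglongrightarrow> (1 / 2) *\<^sub>R (h + y * y)"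
      by (simp, intro tendsto_intros lim)
    then have "y = (1 / 2) *\<^sub>R (h + y * y)"
      using LIMSEQ_unique LIMSEQ_Suc[OF lim] by blast
    then have "2 *\<^sub>R y = 2 *\<^sub>R ((1 / 2) *\<^sub>R (h + y * y))"
      by simp
    then show ?thesis
      by simp
  qed
  moreover have "z * y = y * z" if z: "z * h = h * z" for z
  proof -
    have eq: "z * sqrt_iter h n = sqrt_iter h n * z" for n
    proof (induction n)
      case (Suc n)
      then have "z * (sqrt_iter h n * sqrt_iter h n) = sqrt_iter h n * sqrt_iter h n * z"
        by (metis mult.assoc)
      then show ?case
        by (simp add: z distrib_left distrib_right)
    qed simp
    have "(\<lambda>n. z * sqrt_iter h n) \<longlonglongrightarrow> z * y" and "(\<lambda>n. sqrt_iter h n * z) \<longlonglongrightarrow> y * z"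
      by (intro tendsto_intros lim)+
    then show ?thesis
      using LIMSEQ_unique eq by simp
  qed
  ultimately show ?thesis
    using that by blast
qed

section \<open>Positive semidefinite forms and positive functionals\<close>

lemma exists_unit_rotation:
  obtains c where "cmod c = 1" "c * z = complex_of_real (cmod z)"
proof (cases "z = 0")
  case True
  then show ?thesis
    using that[of 1] by simp
next
  case False
  have "cnj (sgn z) * z = cnj (sgn z) * sgn z * of_real (cmod z)"
    using False by (simp add: sgn_eq)
  also have "\<dots> = of_real (cmod z)"
    using complex_norm_square[of "sgn z"] False by (simp add: norm_sgn mult.commute)
  finally show ?thesis
    using that[of "cnj (sgn z)"] False by (simp add: norm_sgn)
qed

locale semi_inner_product =
  fixes B :: "'v::complex_normed_vector \<Rightarrow> 'v \<Rightarrow> complex"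
  assumes add_right: "B x (y + z) = B x y + B x z"
    and scaleC_right: "B x (c *\<^sub>C y) = c * B x y"
    and hermitian: "B y x = cnj (B x y)"
    and nonneg: "B x x \<in> \<real>\<^sub>\<ge>\<^sub>0"
begin

lemma add_left: "B (x + y) z = B x z + B y z"
  using hermitian[of "x + y" z] hermitian[of x z] hermitian[of y z] by (simp add: add_right)

lemma scaleC_left: "B (c *\<^sub>C x) y = cnj c * B x y"
  using hermitian[of "c *\<^sub>C x" y] hermitian[of x y] by (simp add: scaleC_right)

lemma minus_right: "B x (- y) = - B x y"
  using scaleC_right[of x "- 1" y] by simp

lemma minus_left: "B (- x) y = - B x y"
  using scaleC_left[of "- 1" x y] by simp

lemma diff_right: "B x (y - z) = B x y - B x z"
  using add_right[of x y "- z"] by (simp add: minus_right)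

lemma diff_left: "B (x - y) z = B x z - B y z"
  using add_left[of x "- y" z] by (simp add: minus_left)

lemma zero_right [simp]: "B x 0 = 0"
  using scaleC_right[of x 0 0] by simp

definition snorm :: "'v \<Rightarrow> real" where
  "snorm x = sqrt (Re (B x x))"

lemma snorm_nonneg [simp]: "0 \<le> snorm x"
  using nonneg[of x] by (simp add: snorm_def complex_nonneg_Reals_iff)

lemma diagonal_eq: "B x x = of_real ((snorm x)\<^sup>2)"
  using nonneg[of x] by (simp add: snorm_def complex_nonneg_Reals_iff complex_eq_iff)

lemma snorm_power2: "(snorm x)\<^sup>2 = Re (B x x)"
  using diagonal_eq[of x] by simp

lemma snorm_scaleC: "snorm (c *\<^sub>C x) = cmod c * snorm x"
proof -
  have "c * (cnj c * of_real ((snorm x)\<^sup>2)) = complex_of_real ((cmod c)\<^sup>2 * (snorm x)\<^sup>2)"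
    by (simp only: of_real_mult complex_norm_square ac_simps)
  then have "(snorm (c *\<^sub>C x))\<^sup>2 = (cmod c * snorm x)\<^sup>2"
    by (simp only: snorm_power2[of "c *\<^sub>C x"] scaleC_left scaleC_right diagonal_eq[of x]
        Re_complex_of_real power_mult_distrib)
  then show ?thesis
    by (rule power2_eq_imp_eq) simp_all
qed

lemma snorm_minus [simp]: "snorm (- x) = snorm x"
  by (simp add: snorm_def minus_left minus_right)

lemma snorm_minus_commute: "snorm (x - y) = snorm (y - x)"
  using snorm_minus[of "x - y"] by simp

lemma snorm_zero [simp]: "snorm 0 = 0"
  by (simp add: snorm_def)

lemma snorm_add_power2: "(snorm (x + y))\<^sup>2 = (snorm x)\<^sup>2 + (snorm y)\<^sup>2 + 2 * Re (B x y)"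
  using hermitian[of x y] by (simp add: snorm_power2 add_left add_right)

lemma Cauchy_Schwarz: "cmod (B x y) \<le> snorm x * snorm y"
proof -
  obtain c where c: "cmod c = 1" "c * B x y = of_real (cmod (B x y))"
    by (rule exists_unit_rotation)
  let ?r = "cmod (B x y)"
  \<comment> \<open>A quadratic polynomial in \<open>t\<close>, the square of the seminorm of \<open>t x - c y\<close>; below it is
    evaluated at its minimum \<open>t = r / (snorm x)\<^sup>2\<close>.\<close>
  have quad: "0 \<le> (t * snorm x)\<^sup>2 + (snorm y)\<^sup>2 - 2 * (t * ?r)" for t :: real
  proof -
    have "0 \<le> (snorm (of_real t *\<^sub>C x + (- c) *\<^sub>C y))\<^sup>2"
      by simp
    also have "\<dots> = (t * snorm x)\<^sup>2 + (snorm y)\<^sup>2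
        + 2 * Re (cnj (of_real t) * ((- c) * B x y))"
      by (simp only: snorm_add_power2 snorm_scaleC scaleC_left scaleC_right norm_minus_cancel
          norm_of_real power_mult_distrib power2_abs c(1) mult_1 power_one mult.left_commute)
    also have "(- c) * B x y = of_real (- ?r)"
      using c(2) by simp
    finally have "0 \<le> (t * snorm x)\<^sup>2 + (snorm y)\<^sup>2 + 2 * Re (cnj (of_real t) * of_real (- ?r))" .
    then show ?thesis
      by simp
  qed
  show ?thesis
  proof (cases "snorm x = 0")
    case True
    have "?r = 0"
    proof (rule ccontr)
      assume "?r \<noteq> 0"
      with quad[of "((snorm y)\<^sup>2 + 1) / (2 * ?r)"] True show False
        by (simp add: field_simps)
    qed
    then show ?thesis
      by simp
  next
    case False
    let ?t = "?r / snorm x"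
    have t: "?t / snorm x * snorm x = ?t" "?t / snorm x * ?r = ?t\<^sup>2"
      using False by (simp_all add: power2_eq_square)
    have "?t\<^sup>2 \<le> (snorm y)\<^sup>2"
      using quad[of "?t / snorm x"] unfolding t by linarith
    then have "?r / snorm x \<le> snorm y"
      by (rule power2_le_imp_le) simp
    then have "?r / snorm x * snorm x \<le> snorm y * snorm x"
      by (rule mult_right_mono) simp
    with False show ?thesis
      by (simp add: mult.commute)
  qed
qed

lemma snorm_triangle: "snorm (x + y) \<le> snorm x + snorm y"
proof (rule power2_le_imp_le)
  have "Re (B x y) \<le> snorm x * snorm y"
    by (rule order_trans[OF complex_Re_le_cmod Cauchy_Schwarz])
  then show "(snorm (x + y))\<^sup>2 \<le> (snorm x + snorm y)\<^sup>2"
    by (simp add: snorm_add_power2 power2_sum)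
qed simp

lemma snorm_triangle_diff: "snorm (x - z) \<le> snorm (x - y) + snorm (y - z)"
  using snorm_triangle[of "x - y" "y - z"] by simp

lemma snorm_triangle_sub: "\<bar>snorm x - snorm y\<bar> \<le> snorm (x - y)"
  using snorm_triangle[of "x - y" y] snorm_triangle[of "y - x" x] snorm_minus_commute[of x y]
  by simp

end

locale positive_functional =
  fixes \<phi> :: "'a::cstar_algebra \<Rightarrow> complex"
  assumes add: "\<phi> (x + y) = \<phi> x + \<phi> y"
    and scaleC: "\<phi> (c *\<^sub>C x) = c * \<phi> x"
    and positive: "\<phi> (x\<^sup>\<star> * x) \<in> \<real>\<^sub>\<ge>\<^sub>0"

sublocale positive_functional \<subseteq> form: semi_inner_product "\<lambda>x y. \<phi> (x\<^sup>\<star> * y)"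
proof
  fix x y z :: 'a and c
  show "\<phi> (x\<^sup>\<star> * (y + z)) = \<phi> (x\<^sup>\<star> * y) + \<phi> (x\<^sup>\<star> * z)"
    by (simp add: distrib_left add)
  show "\<phi> (x\<^sup>\<star> * c *\<^sub>C y) = c * \<phi> (x\<^sup>\<star> * y)"
    by (simp add: mult_scaleC_right scaleC)
  show "\<phi> (x\<^sup>\<star> * x) \<in> \<real>\<^sub>\<ge>\<^sub>0"
    by (rule positive)
  have im: "Im (\<phi> (u\<^sup>\<star> * u)) = 0" for u
    using positive[of u] by (simp add: complex_nonneg_Reals_iff)
  have expand: "\<phi> ((x + d *\<^sub>C y)\<^sup>\<star> * (x + d *\<^sub>C y)) = \<phi> (x\<^sup>\<star> * x) + d * \<phi> (x\<^sup>\<star> * y)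
      + cnj d * \<phi> (y\<^sup>\<star> * x) + cnj d * d * \<phi> (y\<^sup>\<star> * y)" for d
    by (simp add: star_add star_scaleC distrib_left distrib_right add scaleC mult_scaleC_left
        mult_scaleC_right scaleC_scaleC algebra_simps)
  have "Im (\<phi> (x\<^sup>\<star> * y)) + Im (\<phi> (y\<^sup>\<star> * x)) = 0"
    using im[of "x + 1 *\<^sub>C y"] unfolding expand by (simp add: im)
  moreover have "Re (\<phi> (x\<^sup>\<star> * y)) - Re (\<phi> (y\<^sup>\<star> * x)) = 0"
    using im[of "x + \<i> *\<^sub>C y"] unfolding expand by (simp add: im)
  ultimately show "\<phi> (y\<^sup>\<star> * x) = cnj (\<phi> (x\<^sup>\<star> * y))"
    by (simp add: complex_eq_iff)
qed

context positive_functional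
begin

lemma minus: "\<phi> (- x) = - \<phi> x"
  using scaleC[of "- 1" x] by simp

lemma diff: "\<phi> (x - y) = \<phi> x - \<phi> y"
  using add[of x "- y"] by (simp add: minus)

lemma scaleR: "\<phi> (r *\<^sub>R x) = of_real r * \<phi> x"
  by (simp add: scaleR_scaleC scaleC)

text \<open>Assume \<open>norm a \<le> 1\<close> and write \<open>a\<^sup>\<star> * a = 2y - y\<^sup>2\<close> with a hermitian \<open>y\<close>. The difference of
  the two sides is then \<open>\<phi> ((x - y x)\<^sup>\<star> (x - y x))\<close>.\<close>

lemma snorm_mult_le: "form.snorm (a * x) \<le> norm a * form.snorm x"
proof -
  have unit: "form.snorm (a * x) \<le> form.snorm x" if "norm a \<le> 1" for a
  proof -
    have "norm (a\<^sup>\<star> * a) \<le> 1"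
      using that by (simp add: cstar_identity power_le_one)
    moreover have "(a\<^sup>\<star> * a)\<^sup>\<star> = a\<^sup>\<star> * a"
      by (simp add: star_mult star_star)
    ultimately obtain y where y: "y\<^sup>\<star> = y" "2 *\<^sub>R y - y * y = a\<^sup>\<star> * a"
      using exists_one_minus_sqrt by metis
    have "(x - y * x)\<^sup>\<star> * (x - y * x) = x\<^sup>\<star> * x - x\<^sup>\<star> * (2 *\<^sub>R y - y * y) * x"
      by (simp add: star_diff star_mult y(1) algebra_simps scaleR_2)
    also have "\<dots> = x\<^sup>\<star> * x - (a * x)\<^sup>\<star> * (a * x)"
      unfolding y(2) by (simp add: star_mult mult.assoc)
    finally have "(form.snorm (x - y * x))\<^sup>2 = (form.snorm x)\<^sup>2 - (form.snorm (a * x))\<^sup>2"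
      unfolding form.snorm_power2 by (simp add: diff)
    then have "(form.snorm (a * x))\<^sup>2 \<le> (form.snorm x)\<^sup>2"
      using zero_le_power2[of "form.snorm (x - y * x)"] by linarith
    then show ?thesis
      by (rule power2_le_imp_le) simp
  qed
  show ?thesis
  proof (cases "a = 0")
    case False
    let ?b = "complex_of_real (inverse (norm a)) *\<^sub>C a"
    have r: "cmod (complex_of_real (inverse (norm a))) = inverse (norm a)"
      by (simp only: norm_of_real) simp
    with False have "norm ?b \<le> 1"
      by (simp add: norm_scaleC del: of_real_inverse)
    from unit[OF this] have "inverse (norm a) * form.snorm (a * x) \<le> form.snorm x"
      by (simp only: mult_scaleC_left form.snorm_scaleC r)
    then have "norm a * (inverse (norm a) * form.snorm (a * x)) \<le> norm a * form.snorm x"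
      by (rule mult_left_mono) simp
    moreover have "norm a * (inverse (norm a) * form.snorm (a * x)) = form.snorm (a * x)"
      using False by simp
    ultimately show ?thesis
      by simp
  qed simp
qed

text \<open>For nonzero \<open>a\<close> and \<open>b\<close>, the bound \<open>\<parallel>a\<parallel> \<parallel>b\<parallel> \<le> snorm a * snorm b\<close> from the Cauchy-Schwarz
  inequality forces the seminorms of \<open>a\<close> and \<open>b\<close> to equal their norms; then a suitable \<open>a + \<alpha> b\<close> has seminorm \<open>norm a + norm b\<close>.\<close>

lemma norm_parallel_if_extremal:
  assumes square_le: "\<And>x. form.snorm x \<le> norm x"
    and extremal: "cmod (\<phi> (a\<^sup>\<star> * b)) = norm a * norm b"
  shows "norm_parallel a b"
proof (cases "a = 0 \<or> b = 0")
  case True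
  then show ?thesis
    unfolding norm_parallel_def using norm_one[where 'a = complex] by (metis add.left_neutral
        add.right_neutral norm_zero scaleC_one)
next
  case False
  have "norm a * norm b \<le> form.snorm a * form.snorm b"
    using form.Cauchy_Schwarz[of a b] extremal by simp
  moreover have "form.snorm a * form.snorm b \<le> norm a * form.snorm b"
    and "form.snorm a * form.snorm b \<le> form.snorm a * norm b"
    by (intro mult_right_mono mult_left_mono square_le; simp)+
  ultimately have "norm a * norm b \<le> norm a * form.snorm b"
    and "norm a * norm b \<le> form.snorm a * norm b"
    by linarith+
  with False have "norm b \<le> form.snorm b" "norm a \<le> form.snorm a"
    by simp_all
  then have norms: "form.snorm b = norm b" "form.snorm a = norm a"
    using square_le[of a] square_le[of b] by linarith+
  obtain \<alpha> where \<alpha>: "cmod \<alpha> = 1" "\<alpha> * \<phi> (a\<^sup>\<star> * b) = of_real (norm a * norm b)"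
    using exists_unit_rotation[of "\<phi> (a\<^sup>\<star> * b)"] unfolding extremal by blast
  have "(form.snorm (a + \<alpha> *\<^sub>C b))\<^sup>2 = (norm a + norm b)\<^sup>2"
    unfolding form.snorm_add_power2 form.snorm_scaleC form.scaleC_right \<alpha> norms
    by (simp add: power2_sum)
  then have "form.snorm (a + \<alpha> *\<^sub>C b) = norm a + norm b"
    by (rule power2_eq_imp_eq) simp_all
  then have "norm a + norm b \<le> norm (a + \<alpha> *\<^sub>C b)"
    using square_le[of "a + \<alpha> *\<^sub>C b"] by simp
  moreover have "norm (a + \<alpha> *\<^sub>C b) \<le> norm a + norm b"
    using norm_triangle_ineq[of a "\<alpha> *\<^sub>C b"] \<alpha>(1) by (simp add: norm_scaleC)
  ultimately have "norm (a + \<alpha> *\<^sub>C b) = norm a + norm b"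
    by linarith
  with \<alpha>(1) show ?thesis
    unfolding norm_parallel_def by blast
qed

end

section \<open>The positive cone of a unital C*-algebra\<close>

class unital_cstar_algebra = cstar_algebra + real_normed_algebra_1

lemma star_one [simp]: "(1::'a::unital_cstar_algebra)\<^sup>\<star> = 1"
  using star_mult[of "1\<^sup>\<star>" "1::'a"] by (simp add: star_star)

definition psd :: "'a::cstar_algebra \<Rightarrow> bool" where
  "psd h \<longleftrightarrow> (\<exists>s. s\<^sup>\<star> = s \<and> h = s * s)"

lemma psd_square: "s\<^sup>\<star> = s \<Longrightarrow> psd (s * s)"
  by (auto simp: psd_def)

lemma psd_zero: "psd 0"
  using psd_square[of 0] by simp

lemma psd_hermitian: "psd h \<Longrightarrow> h\<^sup>\<star> = h"
  by (auto simp: psd_def star_mult)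

lemma psd_scaleR:
  assumes "psd h" "0 \<le> c"
  shows "psd (c *\<^sub>R h)"
proof -
  from assms(1) obtain s where "s\<^sup>\<star> = s" "h = s * s"
    by (auto simp: psd_def)
  with assms(2) show ?thesis
    using psd_square[of "sqrt c *\<^sub>R s"] by simp
qed

text \<open>For \<open>norm s \<le> 1\<close> the element \<open>u = s + i sqrt (1 - s\<^sup>2)\<close> is unitary, and
  \<open>1/2 - s\<^sup>2 = - (u\<^sup>2 + (u\<^sup>\<star>)\<^sup>2) / 4\<close>.\<close>

lemma norm_half_minus_square_unit:
  fixes s :: "'a::unital_cstar_algebra"
  assumes herm: "s\<^sup>\<star> = s" and "norm s \<le> 1"
  shows "norm ((1 / 2) *\<^sub>R 1 - s * s) \<le> 1 / 2"
proof -
  have "norm (s * s) \<le> 1" "(s * s)\<^sup>\<star> = s * s"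
    using assms by (simp_all add: norm_hermitian_square power_le_one star_mult)
  then obtain y where y: "y\<^sup>\<star> = y" "2 *\<^sub>R y - y * y = s * s"
    and comm: "\<And>z. z * (s * s) = s * s * z \<Longrightarrow> z * y = y * z"
    using exists_one_minus_sqrt[of "s * s"] by blast
  define w where "w = 1 - y"
  have w: "w\<^sup>\<star> = w"
    by (simp add: w_def star_diff y(1))
  have ww: "w * w = 1 - s * s"
    unfolding y(2)[symmetric] by (simp add: w_def algebra_simps scaleR_2)
  have "s * y = y * s"
    by (rule comm) (simp add: mult.assoc)
  then have sw: "w * s = s * w"
    by (simp add: w_def algebra_simps)
  define u where "u = s + \<i> *\<^sub>C w"
  have u_star: "u\<^sup>\<star> = s - \<i> *\<^sub>C w"
    by (simp add: u_def star_add star_scaleC herm w)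
  have "u\<^sup>\<star> * u = s * s + w * w"
    by (simp add: u_star) (simp add: u_def algebra_simps mult_scaleC_left mult_scaleC_right
        scaleC_scaleC scaleC_diff_right sw)
  then have "(norm u)\<^sup>2 = 1"
    using cstar_identity[of u] by (simp add: ww)
  then have norm_u: "norm u = 1"
    using norm_ge_zero[of u] unfolding power2_eq_1_iff by linarith
  have "norm (u * u + u\<^sup>\<star> * u\<^sup>\<star>) \<le> norm u * norm u + norm (u\<^sup>\<star>) * norm (u\<^sup>\<star>)"
    by (intro norm_triangle_le add_mono norm_mult_ineq)
  then have "norm (u * u + u\<^sup>\<star> * u\<^sup>\<star>) \<le> 2"
    by (simp add: norm_u)
  moreover have "(1 / 2) *\<^sub>R 1 - s * s = (- 1 / 4) *\<^sub>R (u * u + u\<^sup>\<star> * u\<^sup>\<star>)"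
  proof -
    have "u * u + u\<^sup>\<star> * u\<^sup>\<star> = 2 *\<^sub>R (s * s - w * w)"
      by (simp add: u_star) (simp add: u_def algebra_simps mult_scaleC_left mult_scaleC_right
          scaleC_scaleC scaleC_diff_right scaleC_add_right sw scaleR_2)
    also have "\<dots> = 4 *\<^sub>R (s * s) - 2 *\<^sub>R 1"
      by (simp add: ww algebra_simps flip: scaleR_2)
    finally have sum: "u * u + u\<^sup>\<star> * u\<^sup>\<star> = 4 *\<^sub>R (s * s) - 2 *\<^sub>R 1" .
    show ?thesis
      unfolding sum by (simp add: scaleR_diff_right)
  qed
  ultimately show ?thesis
    by (simp only: norm_scaleR)
qed

lemma norm_half_minus_psd:
  fixes h :: "'a::unital_cstar_algebra"
  assumes "psd h" "norm h \<le> T"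
  shows "norm ((T / 2) *\<^sub>R 1 - h) \<le> T / 2"
proof (cases "T = 0")
  case True
  with assms show ?thesis
    by simp
next
  case False
  with assms(2) have T: "0 < T"
    using norm_ge_zero[of h] by linarith
  from assms(1) obtain s where s: "s\<^sup>\<star> = s" "h = s * s"
    by (auto simp: psd_def)
  let ?s = "inverse (sqrt T) *\<^sub>R s"
  have "norm s \<le> sqrt T"
    using assms(2) s by (simp add: norm_hermitian_square real_le_rsqrt)
  then have "norm ?s \<le> 1"
    using T by (simp add: field_simps)
  then have "norm ((1 / 2) *\<^sub>R 1 - ?s * ?s) \<le> 1 / 2"
    by (intro norm_half_minus_square_unit) (simp_all add: s)
  moreover have "?s * ?s = inverse T *\<^sub>R h"
    using T by (simp add: s flip: inverse_mult_distrib)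
  moreover have "(T / 2) *\<^sub>R 1 - h = T *\<^sub>R ((1 / 2) *\<^sub>R 1 - inverse T *\<^sub>R h)"
    using T by (simp add: scaleR_diff_right)
  ultimately show ?thesis
    using T by simp
qed

text \<open>For \<open>t > 0\<close> the root is \<open>s = sqrt t (1 - y)\<close>, where \<open>y\<close> is \<open>1 - sqrt (1 - k)\<close> for \<open>k = 1 - h / t\<close>. The bound
  on \<open>sqrt t - s\<close>, equivalent to \<open>norm y \<le> 1\<close>, has the same form as the one assumed on \<open>h\<close>; it puts \<open>s\<close>
  into the positive cone again.\<close>

lemma exists_sqrt:
  fixes h :: "'a::unital_cstar_algebra"
  assumes herm: "h\<^sup>\<star> = h" and le: "norm (t *\<^sub>R 1 - h) \<le> t"
  obtains s where "s\<^sup>\<star> = s" "h = s * s" "norm (sqrt t *\<^sub>R 1 - s) \<le> sqrt t"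
    "\<And>z. z * h = h * z \<Longrightarrow> z * s = s * z"
proof (cases "t = 0")
  case True
  with le have "h = 0"
    by simp
  with True that[of 0] show ?thesis
    by simp
next
  case False
  then have t: "0 < t"
    using le norm_ge_zero[of "t *\<^sub>R 1 - h"] by linarith
  let ?k = "1 - inverse t *\<^sub>R h"
  have "t *\<^sub>R 1 - h = t *\<^sub>R ?k"
    using t by (simp add: scaleR_diff_right)
  with le t have "t * norm ?k \<le> t * 1"
    by (metis abs_of_pos mult_1_right norm_scaleR)
  then have "norm ?k \<le> 1"
    using t by (simp only: mult_le_cancel_left_pos)
  moreover have "?k\<^sup>\<star> = ?k"
    by (simp add: star_diff herm)
  ultimately obtain y where y: "y\<^sup>\<star> = y" "norm y \<le> 1" "2 *\<^sub>R y - y * y = ?k"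
    "\<And>z. z * ?k = ?k * z \<Longrightarrow> z * y = y * z"
    using exists_one_minus_sqrt by blast
  show ?thesis
  proof (rule that[of "sqrt t *\<^sub>R (1 - y)"])
    show "(sqrt t *\<^sub>R (1 - y))\<^sup>\<star> = sqrt t *\<^sub>R (1 - y)"
      by (simp add: star_diff y(1))
    have "(1 - y) * (1 - y) = 1 - (2 *\<^sub>R y - y * y)"
      by (simp add: algebra_simps scaleR_2)
    also have "\<dots> = inverse t *\<^sub>R h"
      by (simp add: y(3))
    finally have "t *\<^sub>R ((1 - y) * (1 - y)) = h"
      using t by simp
    then show "h = sqrt t *\<^sub>R (1 - y) * sqrt t *\<^sub>R (1 - y)"
      using t by simp
    have "sqrt t *\<^sub>R 1 - sqrt t *\<^sub>R (1 - y) = sqrt t *\<^sub>R y"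
      by (simp add: scaleR_diff_right)
    then show "norm (sqrt t *\<^sub>R 1 - sqrt t *\<^sub>R (1 - y)) \<le> sqrt t"
      using t y(2) by (simp add: mult_left_le)
    fix z
    assume "z * h = h * z"
    then have "z * y = y * z"
      by (intro y(4)) (simp add: algebra_simps)
    then show "z * sqrt t *\<^sub>R (1 - y) = sqrt t *\<^sub>R (1 - y) * z"
      by (simp add: algebra_simps)
  qed
qed

text \<open>This metric description of the cone makes sums easy.\<close>

lemma psd_iff: "psd h \<longleftrightarrow> h\<^sup>\<star> = h \<and> (\<exists>t. norm (t *\<^sub>R 1 - h) \<le> t)"
  for h :: "'a::unital_cstar_algebra"
proof
  assume "psd h"
  with norm_half_minus_psd[of h "norm h"] psd_hermitian
  show "h\<^sup>\<star> = h \<and> (\<exists>t. norm (t *\<^sub>R 1 - h) \<le> t)"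
    by blast
next
  assume "h\<^sup>\<star> = h \<and> (\<exists>t. norm (t *\<^sub>R 1 - h) \<le> t)"
  then obtain t where "h\<^sup>\<star> = h" "norm (t *\<^sub>R 1 - h) \<le> t"
    by blast
  then show "psd h"
    by (rule exists_sqrt) (use psd_square in blast)
qed

lemma psd_sqrt:
  fixes h :: "'a::unital_cstar_algebra"
  assumes "psd h"
  obtains r where "psd r" "h = r * r" "\<And>z. z * h = h * z \<Longrightarrow> z * r = r * z"
proof -
  from assms obtain t where "h\<^sup>\<star> = h" "norm (t *\<^sub>R 1 - h) \<le> t"
    unfolding psd_iff by blast
  then show ?thesis
  proof (rule exists_sqrt)
    fix r
    assume r: "r\<^sup>\<star> = r" "h = r * r" "norm (sqrt t *\<^sub>R 1 - r) \<le> sqrt t"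
      "\<And>z. z * h = h * z \<Longrightarrow> z * r = r * z"
    from r(1,3) have "psd r"
      unfolding psd_iff by blast
    from this r(2,4) show ?thesis
      by (rule that)
  qed
qed

lemma psd_add:
  fixes h k :: "'a::unital_cstar_algebra"
  assumes "psd h" "psd k"
  shows "psd (h + k)"
proof -
  from assms obtain s t where st: "norm (s *\<^sub>R 1 - h) \<le> s" "norm (t *\<^sub>R 1 - k) \<le> t"
    by (auto simp: psd_iff)
  have "(s *\<^sub>R 1 - h) + (t *\<^sub>R 1 - k) = (s + t) *\<^sub>R 1 - (h + k)"
    by (simp add: scaleR_add_left)
  with norm_triangle_mono[OF st] have "norm ((s + t) *\<^sub>R 1 - (h + k)) \<le> s + t"
    by metis
  then show ?thesis
    using assms by (auto simp: psd_iff star_add)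
qed

lemma psd_scalar_minus:
  fixes h :: "'a::unital_cstar_algebra"
  assumes "h\<^sup>\<star> = h" "norm h \<le> t"
  shows "psd (t *\<^sub>R 1 - h)"
  unfolding psd_iff using assms by (auto simp: star_diff intro!: exI[of _ t])

text \<open>With \<open>s = norm p\<close> and \<open>u = norm (t - p)\<close>, the inequalities of \<open>norm_half_minus_psd\<close> for \<open>p\<close>
  and \<open>t - p\<close> give \<open>u \<le> max t (s - t)\<close> and \<open>s \<le> max t (u - t)\<close>, which is
  impossible for \<open>s > t > 0\<close>.\<close>

lemma norm_le_if_psd_scalar_minus:
  fixes p :: "'a::unital_cstar_algebra"
  assumes p: "psd p" and q: "psd (t *\<^sub>R 1 - p)" and t: "0 < t"
  shows "norm p \<le> t"
proof -
  let ?s = "norm p" and ?u = "norm (t *\<^sub>R 1 - p)"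
  have "(?u / 2) *\<^sub>R 1 - (t *\<^sub>R 1 - p) - (?u / 2 - t) *\<^sub>R 1 = p"
    by (simp add: scaleR_diff_left)
  then have "?s \<le> norm ((?u / 2) *\<^sub>R 1 - (t *\<^sub>R 1 - p)) + norm ((?u / 2 - t) *\<^sub>R (1::'a))"
    by (metis norm_triangle_ineq4)
  then have s: "?s \<le> ?u / 2 + \<bar>?u / 2 - t\<bar>"
    using norm_half_minus_psd[OF q order_refl] by simp
  have "((?s / 2) *\<^sub>R 1 - p) - (?s / 2 - t) *\<^sub>R 1 = t *\<^sub>R 1 - p"
    by (simp add: scaleR_diff_left)
  then have "?u \<le> norm ((?s / 2) *\<^sub>R 1 - p) + norm ((?s / 2 - t) *\<^sub>R (1::'a))"
    by (metis norm_triangle_ineq4)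
  then have "?u \<le> ?s / 2 + \<bar>?s / 2 - t\<bar>"
    using norm_half_minus_psd[OF p order_refl] by simp
  with s t show ?thesis
    by (auto simp: abs_if split: if_splits)
qed

lemma psd_norm_mono:
  fixes p q :: "'a::unital_cstar_algebra"
  assumes p: "psd p" and "psd (q - p)"
  shows "norm p \<le> norm q"
proof (rule field_le_epsilon)
  fix e :: real
  assume e: "0 < e"
  have "psd q"
    using psd_add[OF assms] by simp
  then have "psd ((norm q + e) *\<^sub>R 1 - q)"
    using e by (intro psd_scalar_minus psd_hermitian) simp_all
  from psd_add[OF this assms(2)] have "psd ((norm q + e) *\<^sub>R 1 - p)"
    by simp
  then show "norm p \<le> norm q + e"
    using e by (intro norm_le_if_psd_scalar_minus p) (simp_all add: add_nonneg_pos)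
qed

text \<open>Suppose that \<open>z\<^sup>\<star> z = - w\<^sup>2\<close>. The sum \<open>z z\<^sup>\<star> + z\<^sup>\<star> z\<close> is twice the sum of the squares of the
  real and the imaginary part of \<open>z\<close>, so \<open>g = z z\<^sup>\<star>\<close> is positive. Put \<open>T = norm g = norm (w\<^sup>2)\<close>.
  Then \<open>z (T/2 + w\<^sup>2) = (T/2 - g) z\<close>, and the squared norm of the right-hand side is at most
  \<open>(T/2)\<^sup>2 T\<close>. The squared norm of the left-hand side is the norm of \<open>w\<^sup>2 (T/2 + w\<^sup>2)\<^sup>2 \<ge> T w\<^sup>4\<close>, at
  least \<open>T\<^sup>3\<close>. Hence \<open>T\<^sup>3 \<le> T\<^sup>3/4\<close>.\<close>

lemma eq_zero_if_star_mult_negative: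
  fixes z :: "'a::unital_cstar_algebra"
  assumes w: "w\<^sup>\<star> = w" and zz: "z\<^sup>\<star> * z = - (w * w)"
  shows "z = 0"
proof -
  define g where "g = z * z\<^sup>\<star>"
  define T where "T = (norm z)\<^sup>2"
  have T: "0 \<le> T"
    by (simp add: T_def)
  have norm_g: "norm g = T"
    using cstar_identity[of "z\<^sup>\<star>"] by (simp add: g_def T_def star_star)
  have norm_ww: "norm (w * w) = T"
    using cstar_identity[of z] by (simp add: zz T_def)
  have "psd g"
  proof -
    let ?p = "z + z\<^sup>\<star>" and ?q = "\<i> *\<^sub>C (z - z\<^sup>\<star>)"
    have "?p * ?p + ?q * ?q = ?p * ?p - (z - z\<^sup>\<star>) * (z - z\<^sup>\<star>)"
      by (simp add: mult_scaleC_left mult_scaleC_right scaleC_scaleC)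
    also have "\<dots> = 2 *\<^sub>R (g - w * w)"
      unfolding g_def using zz by (simp add: algebra_simps scaleR_2 add_eq_0_iff)
    finally have "g = (1 / 2) *\<^sub>R (?p * ?p + ?q * ?q) + w * w"
      by simp
    moreover have "?p\<^sup>\<star> = ?p" "?q\<^sup>\<star> = ?q"
      by (simp_all add: star_add star_star star_scaleC star_diff scaleC_diff_right)
    ultimately show ?thesis
      by (metis psd_add psd_square psd_scaleR w zero_le_divide_1_iff zero_le_numeral)
  qed
  define e where "e = (T / 2) *\<^sub>R 1 + w * w"
  have "z * e = ((T / 2) *\<^sub>R 1 - g) * z"
  proof -
    have "z * (w * w) = - (g * z)"
      using zz by (metis g_def minus_minus mult.assoc mult_minus_right)
    then show ?thesis
      by (simp add: e_def distrib_left left_diff_distrib)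
  qed
  then have "norm (z * e) \<le> norm ((T / 2) *\<^sub>R 1 - g) * norm z"
    by (simp add: norm_mult_ineq)
  also have "\<dots> \<le> T / 2 * norm z"
    by (intro mult_right_mono norm_half_minus_psd \<open>psd g\<close>) (simp_all add: norm_g)
  finally have "(norm (z * e))\<^sup>2 \<le> (T / 2 * norm z)\<^sup>2"
    by (rule power_mono) simp
  then have "(norm (z * e))\<^sup>2 \<le> T ^ 3 / 4"
    by (simp add: T_def power_mult_distrib power_divide flip: power_add power_mult)
  moreover have "T ^ 3 \<le> (norm (z * e))\<^sup>2"
  proof -
    have e: "e\<^sup>\<star> = e"
      by (simp add: e_def star_add star_mult w)
    have "T ^ 3 = norm (T *\<^sub>R ((w * w) * (w * w)))"
      using T by (simp add: norm_hermitian_square star_mult w norm_ww power2_eq_square power3_eq_cube)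
    also have "\<dots> \<le> norm (e * (w * w) * e)"
    proof (rule psd_norm_mono)
      show "psd (T *\<^sub>R ((w * w) * (w * w)))"
        by (intro psd_scaleR psd_square T) (simp add: star_mult w)
      have half: "T *\<^sub>R q = (T / 2) *\<^sub>R q + (T / 2) *\<^sub>R q" for q :: 'a
        by (simp flip: scaleR_add_left)
      have "e * q * e - T *\<^sub>R (q * q) = (T / 2) *\<^sub>R ((T / 2) *\<^sub>R q) + q * q * q"
        if "e = (T / 2) *\<^sub>R 1 + q" for q
        unfolding that half[of "q * q"] by (simp add: distrib_left distrib_right
            scaleR_add_right mult.assoc)
      from this[OF e_def]
      have "e * (w * w) * e - T *\<^sub>R ((w * w) * (w * w))
          = ((T / 2) *\<^sub>R w) * ((T / 2) *\<^sub>R w) + (w * w * w) * (w * w * w)"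
        by (simp add: mult.assoc)
      then show "psd (e * (w * w) * e - T *\<^sub>R ((w * w) * (w * w)))"
        by (simp only:) (intro psd_add psd_square; simp add: star_mult w mult.assoc)
    qed
    also have "\<dots> = norm ((z * e)\<^sup>\<star> * (z * e))"
    proof -
      have "(z * e)\<^sup>\<star> * (z * e) = e * (z\<^sup>\<star> * z) * e"
        by (simp add: star_mult e mult.assoc)
      then show ?thesis
        by (simp add: zz)
    qed
    finally show ?thesis
      by (simp only: cstar_identity)
  qed
  ultimately have "T ^ 3 \<le> 0"
    by linarith
  with T have "T = 0"
    by (metis order_antisym power_eq_0_iff zero_le_power)
  then show ?thesis
    by (simp add: T_def)
qed

text \<open>Let \<open>h = x\<^sup>\<star> x\<close> and \<open>m = sqrt (h\<^sup>2)\<close>, the absolute value of \<open>h\<close>. The element \<open>v = m - h\<close>, twice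
  the negative part of \<open>h\<close>, satisfies \<open>h v = - m v\<close>. So \<open>z = x v\<close> has
  \<open>z\<^sup>\<star> z = - m v\<^sup>2\<close>, which is minus a square, and therefore vanishes.\<close>

theorem psd_star_mult: "psd (x\<^sup>\<star> * x)" for x :: "'a::unital_cstar_algebra"
proof -
  define h where "h = x\<^sup>\<star> * x"
  have h: "h\<^sup>\<star> = h"
    by (simp add: h_def star_mult star_star)
  obtain m where m: "psd m" "h * h = m * m" "\<And>z. z * (h * h) = h * h * z \<Longrightarrow> z * m = m * z"
    using psd_sqrt[OF psd_square[OF h]] by blast
  have hm: "h * m = m * h"
    by (rule m(3)) (simp add: mult.assoc)
  obtain r where r: "psd r" "m = r * r" "\<And>z. z * m = m * z \<Longrightarrow> z * r = r * z"
    using psd_sqrt[OF m(1)] by blast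
  define v where "v = m - h"
  have v: "v\<^sup>\<star> = v"
    by (simp add: v_def star_diff h psd_hermitian[OF m(1)])
  have hv: "h * v = - (m * v)"
    by (simp add: v_def right_diff_distrib m(2) hm)
  have vr: "v * r = r * v"
    by (rule r(3)) (simp add: v_def left_diff_distrib right_diff_distrib hm)
  have "(x * v)\<^sup>\<star> * (x * v) = v * (h * v)"
    by (simp add: star_mult v h_def mult.assoc)
  also have "\<dots> = - ((v * r) * (r * v))"
    by (simp add: hv r(2) mult.assoc)
  also have "\<dots> = - ((r * v) * (r * v))"
    by (simp only: vr)
  finally have "x * v = 0"
    by (rule eq_zero_if_star_mult_negative[rotated])
      (simp add: star_mult v psd_hermitian[OF r(1)] vr)
  then have "h * v = 0"
    by (simp add: h_def mult.assoc)
  with hv have "v * v = 0"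
    by (simp add: v_def left_diff_distrib)
  then have "v = 0"
    using norm_hermitian_square[OF v] by simp
  with m(1) show ?thesis
    by (simp add: v_def h_def)
qed

section \<open>Dominated linear functionals\<close>

definition sublinear :: "('a::real_vector \<Rightarrow> real) \<Rightarrow> bool" where
  "sublinear p \<longleftrightarrow> (\<forall>x y. p (x + y) \<le> p x + p y) \<and> (\<forall>c x. 0 < c \<longrightarrow> p (c *\<^sub>R x) \<le> c * p x)"

lemma sublinearI:
  "(\<And>x y. p (x + y) \<le> p x + p y) \<Longrightarrow> (\<And>c x. 0 < c \<Longrightarrow> p (c *\<^sub>R x) \<le> c * p x) \<Longrightarrow> sublinear p"
  by (simp add: sublinear_def)

lemma sublinear_add: "sublinear p \<Longrightarrow> p (x + y) \<le> p x + p y"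
  by (simp add: sublinear_def)

lemma sublinear_scaleR:
  assumes "sublinear p" "0 < c"
  shows "p (c *\<^sub>R x) = c * p x"
proof (rule order_antisym)
  show "p (c *\<^sub>R x) \<le> c * p x"
    using assms by (simp add: sublinear_def)
  have "p (inverse c *\<^sub>R (c *\<^sub>R x)) \<le> inverse c * p (c *\<^sub>R x)"
    using assms unfolding sublinear_def by (meson positive_imp_inverse_positive)
  then show "c * p x \<le> p (c *\<^sub>R x)"
    using assms(2) by (simp add: field_simps)
qed

lemma sublinear_zero: "sublinear p \<Longrightarrow> p 0 = 0"
  using sublinear_scaleR[of p 2 0] by simp

lemma sublinear_ge_minus: "sublinear p \<Longrightarrow> - p (- x) \<le> p x"
  using sublinear_add[of p x "- x"] sublinear_zero[of p] by simp

text \<open>Pushes the value of \<open>q\<close> at \<open>- y\<close> down to its least possible value \<open>- q y\<close>, the term with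
  \<open>t = 1\<close>, while preserving sublinearity. A sublinear functional that cannot be lowered is therefore odd, hence linear.\<close>

definition lower :: "'a::real_vector \<Rightarrow> ('a \<Rightarrow> real) \<Rightarrow> 'a \<Rightarrow> real" where
  "lower y q x = (INF t\<in>{0..}. q (x + t *\<^sub>R y) - t * q y)"

lemma
  assumes q: "sublinear q"
  shows lower_le: "lower y q \<le> q"
    and lower_minus: "lower y q (- y) \<le> - q y"
    and sublinear_lower: "sublinear (lower y q)"
proof -
  have bdd: "bdd_below ((\<lambda>t. q (x + t *\<^sub>R y) - t * q y) ` {0..})" for x
  proof (rule bdd_belowI2)
    fix t :: real
    assume "t \<in> {0..}"
    then have "t * q y = q (t *\<^sub>R y)"
      using sublinear_scaleR[OF q, of t y] sublinear_zero[OF q] by (cases "t = 0") auto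
    also have "\<dots> \<le> q (x + t *\<^sub>R y) + q (- x)"
      using sublinear_add[OF q, of "x + t *\<^sub>R y" "- x"] by simp
    finally show "- q (- x) \<le> q (x + t *\<^sub>R y) - t * q y"
      by simp
  qed
  have shift: "lower y q x \<le> q (x + t *\<^sub>R y) - t * q y" if "0 \<le> t" for t x
    unfolding lower_def by (rule cINF_lower[OF bdd]) (use that in simp)
  show "lower y q \<le> q"
    using shift[of 0] by (simp add: le_fun_def)
  show "lower y q (- y) \<le> - q y"
    using shift[of 1 "- y"] sublinear_zero[OF q] by simp
  have greatest: "m \<le> lower y q x" if "\<And>t. 0 \<le> t \<Longrightarrow> m \<le> q (x + t *\<^sub>R y) - t * q y" for m x
    unfolding lower_def by (rule cINF_greatest) (use that in auto)
  show "sublinear (lower y q)"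
  proof (rule sublinearI)
    fix u v
    have *: "lower y q (u + v) \<le> (q (u + s *\<^sub>R y) - s * q y) + (q (v + t *\<^sub>R y) - t * q y)"
      if "0 \<le> s" "0 \<le> t" for s t
    proof -
      have "lower y q (u + v) \<le> q ((u + s *\<^sub>R y) + (v + t *\<^sub>R y)) - (s + t) * q y"
        using shift[of "s + t" "u + v"] that by (simp add: scaleR_add_left algebra_simps)
      with sublinear_add[OF q, of "u + s *\<^sub>R y" "v + t *\<^sub>R y"] show ?thesis
        by (simp add: algebra_simps)
    qed
    have "lower y q (u + v) - lower y q v \<le> lower y q u"
    proof (rule greatest)
      fix s :: real
      assume s: "0 \<le> s"
      have "lower y q (u + v) - (q (u + s *\<^sub>R y) - s * q y) \<le> lower y q v"
      proof (rule greatest)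
        fix t :: real
        assume "0 \<le> t"
        from *[OF s this]
        show "lower y q (u + v) - (q (u + s *\<^sub>R y) - s * q y) \<le> q (v + t *\<^sub>R y) - t * q y"
          by linarith
      qed
      then show "lower y q (u + v) - lower y q v \<le> q (u + s *\<^sub>R y) - s * q y"
        by linarith
    qed
    then show "lower y q (u + v) \<le> lower y q u + lower y q v"
      by linarith
  next
    fix c :: real and u
    assume c: "0 < c"
    have "lower y q (c *\<^sub>R u) / c \<le> lower y q u"
    proof (rule greatest)
      fix t :: real
      assume "0 \<le> t"
      with c have "lower y q (c *\<^sub>R u) \<le> q (c *\<^sub>R u + (c * t) *\<^sub>R y) - (c * t) * q y"
        by (intro shift) simp
      also have "\<dots> = c * (q (u + t *\<^sub>R y) - t * q y)"
        using sublinear_scaleR[OF q c, of "u + t *\<^sub>R y"] by (simp add: scaleR_add_right algebra_simps)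
      finally show "lower y q (c *\<^sub>R u) / c \<le> q (u + t *\<^sub>R y) - t * q y"
        using c by (simp add: divide_le_eq mult.commute)
    qed
    then show "lower y q (c *\<^sub>R u) \<le> c * lower y q u"
      using c by (simp add: divide_le_eq mult.commute)
  qed
qed

text \<open>The pointwise infimum of a chain of sublinear functionals below \<open>p\<close> is finite, since
  \<open>- p (- x)\<close> is a lower bound at \<open>x\<close>, and again sublinear. So Zorn's lemma applies.\<close>

lemma exists_minimal_sublinear:
  fixes p :: "'a::real_vector \<Rightarrow> real"
  assumes p: "sublinear p"
  obtains m where "sublinear m" "m \<le> p" "\<And>q. sublinear q \<Longrightarrow> q \<le> m \<Longrightarrow> q = m"
proof -
  let ?A = "{q. sublinear q \<and> q \<le> p}"
  have "\<exists>m\<in>?A. \<forall>q\<in>?A. m \<ge> q \<longrightarrow> q = m"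
  proof (rule predicate_Zorn)
    show "partial_order_on ?A (relation_of (\<ge>) ?A)"
      by (rule partial_order_on_relation_ofI) auto
  next
    fix C
    assume C: "C \<in> Chains (relation_of (\<ge>) ?A)"
    then have sub: "sublinear q" "q \<le> p" if "q \<in> C" for q
      using that by (auto simp: Chains_def relation_of_def)
    have total: "q \<le> r \<or> r \<le> q" if "q \<in> C" "r \<in> C" for q r
      using C that by (auto simp: Chains_def relation_of_def)
    show "\<exists>u\<in>?A. \<forall>q\<in>C. q \<ge> u"
    proof (cases "C = {}")
      case True
      then show ?thesis using p by auto
    next
      case False
      define u where "u x = (INF q\<in>C. q x)" for x
      have bdd: "bdd_below ((\<lambda>q. q x) ` C)" for x
      proof (rule bdd_belowI2)
        fix q
        assume "q \<in> C"
        from sublinear_ge_minus[OF sub(1)[OF this], of x] le_funD[OF sub(2)[OF this], of "- x"]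
        show "- p (- x) \<le> q x"
          by linarith
      qed
      have u_le: "u x \<le> q x" if "q \<in> C" for q x
        unfolding u_def by (rule cINF_lower[OF bdd that])
      have u_greatest: "m \<le> u x" if "\<And>q. q \<in> C \<Longrightarrow> m \<le> q x" for m x
        unfolding u_def by (rule cINF_greatest[OF False that])
      have "sublinear u"
      proof (rule sublinearI)
        fix x y
        have *: "u (x + y) \<le> q x + r y" if qr: "q \<in> C" "r \<in> C" for q r
        proof -
          obtain s where s: "s \<in> C" "s \<le> q" "s \<le> r"
            using total[OF qr] qr by blast
          have "u (x + y) \<le> s (x + y)"
            by (rule u_le[OF s(1)])
          also have "\<dots> \<le> s x + s y"
            by (rule sublinear_add[OF sub(1)[OF s(1)]])
          also have "\<dots> \<le> q x + r y"
            using s by (intro add_mono) (auto dest: le_funD)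
          finally show ?thesis .
        qed
        have "u (x + y) - u y \<le> u x"
        proof (rule u_greatest)
          fix q
          assume q: "q \<in> C"
          have "u (x + y) - q x \<le> u y"
            by (rule u_greatest) (use *[OF q] in \<open>simp add: algebra_simps\<close>)
          then show "u (x + y) - u y \<le> q x"
            by linarith
        qed
        then show "u (x + y) \<le> u x + u y"
          by linarith
      next
        fix c :: real and x
        assume c: "0 < c"
        have "u (c *\<^sub>R x) / c \<le> u x"
        proof (rule u_greatest)
          fix q
          assume q: "q \<in> C"
          have "u (c *\<^sub>R x) \<le> c * q x"
            using u_le[OF q, of "c *\<^sub>R x"] sublinear_scaleR[OF sub(1)[OF q] c, of x] by simp
          then show "u (c *\<^sub>R x) / c \<le> q x"
            using c by (simp add: divide_le_eq mult.commute)
        qed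
        then show "u (c *\<^sub>R x) \<le> c * u x"
          using c by (simp add: divide_le_eq mult.commute)
      qed
      moreover have "u \<le> p"
      proof (rule le_funI)
        fix x
        from False obtain q where "q \<in> C"
          by blast
        from u_le[OF this, of x] le_funD[OF sub(2)[OF this], of x] show "u x \<le> p x"
          by linarith
      qed
      ultimately show ?thesis
        using u_le by (intro bexI[of _ u]) (auto simp: le_fun_def)
    qed
  qed
  then obtain m where m: "sublinear m" "m \<le> p" "\<And>q. sublinear q \<Longrightarrow> q \<le> p \<Longrightarrow> q \<le> m \<Longrightarrow> q = m"
    by blast
  then show ?thesis
    using that[of m] order_trans by blast
qed

text \<open>The Hahn-Banach theorem: a minimal sublinear functional is linear. Starting below \<open>lower h p\<close>
  instead of \<open>p\<close> yields \<open>f (- h) \<le> - p h\<close>, hence \<open>f h = p h\<close>.\<close>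

theorem exists_linear_dominated:
  fixes p :: "'a::real_vector \<Rightarrow> real"
  assumes p: "sublinear p"
  obtains f where "linear f" "\<And>x. f x \<le> p x" "f h = p h"
proof -
  obtain m where m: "sublinear m" "m \<le> lower h p" "\<And>q. sublinear q \<Longrightarrow> q \<le> m \<Longrightarrow> q = m"
    using exists_minimal_sublinear[OF sublinear_lower[OF p, of h]] by blast
  have neg: "m (- y) = - m y" for y
  proof (rule order_antisym)
    have "lower y m = m"
      by (intro m(3) sublinear_lower lower_le m(1))
    with lower_minus[OF m(1), of y] show "m (- y) \<le> - m y"
      by simp
    show "- m y \<le> m (- y)"
      using sublinear_ge_minus[OF m(1), of "- y"] by simp
  qed
  have "linear m"
  proof (rule linearI)
    fix x y
    show "m (x + y) = m x + m y"
      using sublinear_add[OF m(1), of x y] sublinear_add[OF m(1), of "x + y" "- y"] neg[of y]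
      by simp
  next
    fix c :: real and x
    consider "c = 0" | "0 < c" | "0 < - c"
      by linarith
    then show "m (c *\<^sub>R x) = c *\<^sub>R m x"
    proof cases
      case 1
      then show ?thesis
        by (simp add: sublinear_zero[OF m(1)])
    next
      case 2
      then show ?thesis
        by (simp add: sublinear_scaleR[OF m(1)])
    next
      case 3
      from sublinear_scaleR[OF m(1) 3, of x] show ?thesis
        by (simp add: neg)
    qed
  qed
  moreover have le: "m x \<le> p x" for x
    using le_funD[OF m(2), of x] le_funD[OF lower_le[OF p, of h], of x] by linarith
  moreover have "m h = p h"
    using le[of h] le_funD[OF m(2), of "- h"] lower_minus[OF p, of h] neg[of h] by linarith
  ultimately show ?thesis
    using that by blast
qed

section \<open>States that attain the norm of a positive element\<close>

text \<open>The distance from \<open>x\<close> to the negative of the positive cone is a sublinear functional; a linear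
  functional below it is contractive and nonnegative on the cone. At an element of the cone it
  equals the norm, by monotonicity of the norm on the cone.\<close>

definition cone_dist :: "'a::unital_cstar_algebra \<Rightarrow> real" where
  "cone_dist x = (INF s\<in>Collect psd. norm (x + s))"

lemma cone_dist_le: "psd s \<Longrightarrow> cone_dist x \<le> norm (x + s)"
  unfolding cone_dist_def by (rule cINF_lower) (auto intro: bdd_belowI2[where m = 0])

lemma cone_dist_greatest: "(\<And>s. psd s \<Longrightarrow> m \<le> norm (x + s)) \<Longrightarrow> m \<le> cone_dist x"
  unfolding cone_dist_def using psd_zero by (intro cINF_greatest) auto

lemma sublinear_cone_dist: "sublinear (cone_dist :: 'a::unital_cstar_algebra \<Rightarrow> real)"
proof (rule sublinearI)
  fix x y :: 'a
  have "cone_dist (x + y) - cone_dist y \<le> cone_dist x"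
  proof (rule cone_dist_greatest)
    fix s :: 'a
    assume s: "psd s"
    have "cone_dist (x + y) - norm (x + s) \<le> cone_dist y"
    proof (rule cone_dist_greatest)
      fix t :: 'a
      assume "psd t"
      then have "cone_dist (x + y) \<le> norm ((x + y) + (s + t))"
        by (intro cone_dist_le psd_add s)
      also have "(x + y) + (s + t) = (x + s) + (y + t)"
        by simp
      also have "norm \<dots> \<le> norm (x + s) + norm (y + t)"
        by (rule norm_triangle_ineq)
      finally show "cone_dist (x + y) - norm (x + s) \<le> norm (y + t)"
        by simp
    qed
    then show "cone_dist (x + y) - cone_dist y \<le> norm (x + s)"
      by simp
  qed
  then show "cone_dist (x + y) \<le> cone_dist x + cone_dist y"
    by simp
next
  fix c :: real and x :: 'a
  assume c: "0 < c"
  have "cone_dist (c *\<^sub>R x) / c \<le> cone_dist x"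
  proof (rule cone_dist_greatest)
    fix s :: 'a
    assume "psd s"
    with c have "cone_dist (c *\<^sub>R x) \<le> norm (c *\<^sub>R x + c *\<^sub>R s)"
      by (intro cone_dist_le psd_scaleR) simp_all
    also have "\<dots> = c * norm (x + s)"
      using c by (simp flip: scaleR_add_right)
    finally show "cone_dist (c *\<^sub>R x) / c \<le> norm (x + s)"
      using c by (simp add: divide_le_eq mult.commute)
  qed
  then show "cone_dist (c *\<^sub>R x) \<le> c * cone_dist x"
    using c by (simp add: divide_le_eq mult.commute)
qed

text \<open>A real-linear functional \<open>f\<close> becomes a complex-linear one that agrees with \<open>f\<close> on hermitian
  elements by symmetrizing it with respect to the involution and then using
  \<open>g (x) - i g (i x)\<close>.\<close>

definition complexify :: "('a::cstar_algebra \<Rightarrow> real) \<Rightarrow> 'a \<Rightarrow> complex" where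
  "complexify f x = (let g = \<lambda>x. (f x + f (x\<^sup>\<star>)) / 2 in Complex (g x) (- g (\<i> *\<^sub>C x)))"

lemma
  fixes f :: "'a::cstar_algebra \<Rightarrow> real"
  assumes f: "linear f"
  shows complexify_add: "complexify f (x + y) = complexify f x + complexify f y"
    and complexify_scaleC: "complexify f (c *\<^sub>C x) = c * complexify f x"
    and complexify_hermitian: "x\<^sup>\<star> = x \<Longrightarrow> complexify f x = of_real (f x)"
    and cmod_complexify_le: "(\<And>x. \<bar>f x\<bar> \<le> norm x) \<Longrightarrow> cmod (complexify f x) \<le> norm x"
proof -
  note f_simps = linear_add[OF f] linear_scale[OF f] linear_neg[OF f] linear_diff[OF f]
  show add: "complexify f (x + y) = complexify f x + complexify f y" for x y
    by (simp add: complexify_def complex_eq_iff star_add scaleC_add_right f_simps field_simps)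
  have real: "complexify f (r *\<^sub>R x) = of_real r * complexify f x" for r x
    by (simp add: complexify_def complex_eq_iff scaleC_scaleR f_simps field_simps)
  have imaginary: "complexify f (\<i> *\<^sub>C x) = \<i> * complexify f x" for x
    by (simp add: complexify_def complex_eq_iff scaleC_scaleC star_scaleC f_simps field_simps)
  show scale: "complexify f (c *\<^sub>C x) = c * complexify f x" for c x
  proof -
    have "c *\<^sub>C x = Re c *\<^sub>R x + Im c *\<^sub>R (\<i> *\<^sub>C x)"
      by (simp add: scaleR_scaleC scaleC_scaleC mult.commute
          flip: scaleC_add_left complex_eq)
    then have "complexify f (c *\<^sub>C x) = (of_real (Re c) + of_real (Im c) * \<i>) * complexify f x"
      by (simp only: add real imaginary distrib_right mult.assoc)
    then show ?thesis
      by (simp add: mult.commute[of _ \<i>] flip: complex_eq)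
  qed
  show "complexify f x = of_real (f x)" if "x\<^sup>\<star> = x" for x
    using that by (simp add: complexify_def complex_eq_iff star_scaleC f_simps)
  show "cmod (complexify f x) \<le> norm x" if bound: "\<And>x. \<bar>f x\<bar> \<le> norm x"
  proof -
    obtain c where c: "cmod c = 1" "c * complexify f x = of_real (cmod (complexify f x))"
      by (rule exists_unit_rotation)
    have "cmod (complexify f x) = Re (complexify f (c *\<^sub>C x))"
      by (simp only: scale c(2) Re_complex_of_real)
    also have "\<dots> = (f (c *\<^sub>C x) + f ((c *\<^sub>C x)\<^sup>\<star>)) / 2"
      by (simp add: complexify_def)
    also have "\<dots> \<le> norm (c *\<^sub>C x)"
      using bound[of "c *\<^sub>C x"] bound[of "(c *\<^sub>C x)\<^sup>\<star>"] by simp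
    finally show ?thesis
      by (simp add: norm_scaleC c(1))
  qed
qed

theorem exists_norming_positive_functional:
  fixes c :: "'a::unital_cstar_algebra"
  assumes "c \<noteq> 0"
  obtains \<phi> where "positive_functional \<phi>" "\<And>x. cmod (\<phi> x) \<le> norm x" "\<phi> 1 = 1"
    "\<phi> (c\<^sup>\<star> * c) = of_real ((norm c)\<^sup>2)"
proof -
  let ?h = "c\<^sup>\<star> * c"
  obtain f where f: "linear f" and le: "\<And>x. f x \<le> cone_dist x" and fh: "f ?h = cone_dist ?h"
    using exists_linear_dominated[OF sublinear_cone_dist] by blast
  have "cone_dist ?h = norm ?h"
  proof (rule order_antisym)
    show "cone_dist ?h \<le> norm ?h"
      using cone_dist_le[OF psd_zero, of ?h] by simp
    show "norm ?h \<le> cone_dist ?h"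
      by (rule cone_dist_greatest) (simp add: psd_norm_mono psd_star_mult)
  qed
  with fh have fh: "f ?h = (norm c)\<^sup>2"
    by (simp add: cstar_identity)
  have f_le: "f x \<le> norm x" for x
    using le[of x] cone_dist_le[OF psd_zero, of x] by simp
  have f_abs: "\<bar>f x\<bar> \<le> norm x" for x
    using f_le[of x] f_le[of "- x"] by (simp add: linear_neg[OF f] abs_le_iff)
  have f_psd: "0 \<le> f s" if "psd s" for s
    using le[of "- s"] cone_dist_le[OF that, of "- s"] by (simp add: linear_neg[OF f])
  have "f 1 = 1"
  proof (rule order_antisym)
    show "f 1 \<le> 1"
      using f_le[of 1] by simp
    have "psd ((norm c)\<^sup>2 *\<^sub>R 1 - ?h)"
      by (intro psd_scalar_minus) (simp_all add: star_mult star_star cstar_identity)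
    from f_psd[OF this] have "(norm c)\<^sup>2 * 1 \<le> (norm c)\<^sup>2 * f 1"
      by (simp add: linear_diff[OF f] linear_scale[OF f] fh)
    with assms show "1 \<le> f 1"
      by (simp add: mult_le_cancel_left1)
  qed
  note on_hermitian = complexify_hermitian[OF f]
  show ?thesis
  proof (rule that[of "complexify f"])
    show "positive_functional (complexify f)"
    proof
      fix x :: 'a
      show "complexify f (x\<^sup>\<star> * x) \<in> \<real>\<^sub>\<ge>\<^sub>0"
        by (simp add: on_hermitian star_mult star_star f_psd psd_star_mult)
    qed (simp_all add: complexify_add[OF f] complexify_scaleC[OF f])
    show "cmod (complexify f x) \<le> norm x" for x
      by (rule cmod_complexify_le[OF f f_abs])
    show "complexify f 1 = 1"
      by (simp add: on_hermitian \<open>f 1 = 1\<close>)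
    show "complexify f ?h = of_real ((norm c)\<^sup>2)"
      by (simp add: on_hermitian star_mult star_star fh)
  qed
qed

section \<open>Adjoining a unit\<close>

datatype 'a unitization = Adjoin (scalar_part: complex) (algebra_part: 'a)

definition left_act :: "'a::cstar_algebra unitization \<Rightarrow> 'a \<Rightarrow> 'a" where
  "left_act u x = scalar_part u *\<^sub>C x + algebra_part u * x"

text \<open>The operator norm of \<^const>\<open>left_act\<close> alone is only a seminorm if the algebra already has
  a unit. The maximum with the modulus of the scalar part is a C*-norm in all cases.\<close>

instantiation unitization :: (cstar_algebra) "{real_normed_algebra_1, complex_normed_vector}"
begin

definition "0 = Adjoin 0 (0::'a)"
definition "1 = Adjoin 1 (0::'a)"
definition "u + v = Adjoin (scalar_part u + scalar_part v) (algebra_part u + algebra_part v :: 'a)"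
definition "u - v = Adjoin (scalar_part u - scalar_part v) (algebra_part u - algebra_part v :: 'a)"
definition "- u = Adjoin (- scalar_part u) (- algebra_part u :: 'a)"
definition "u * v = Adjoin (scalar_part u * scalar_part v)
  (scalar_part u *\<^sub>C algebra_part v + scalar_part v *\<^sub>C algebra_part u
    + algebra_part u * algebra_part v :: 'a)"
definition "r *\<^sub>R u = Adjoin (r *\<^sub>R scalar_part u) (r *\<^sub>R algebra_part u :: 'a)"
definition "c *\<^sub>C u = Adjoin (c * scalar_part u) (c *\<^sub>C algebra_part u :: 'a)"
definition "norm u = max (cmod (scalar_part u)) (onorm (left_act u :: 'a \<Rightarrow> 'a))"
definition "dist u v = norm (u - v :: 'a unitization)"
definition "sgn u = inverse (norm u) *\<^sub>R (u :: 'a unitization)"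
definition "uniformity = (INF e\<in>{0<..}. principal {(u, v :: 'a unitization). dist u v < e})"
definition "open (U :: 'a unitization set) \<longleftrightarrow>
  (\<forall>x\<in>U. eventually (\<lambda>(x', y). x' = x \<longrightarrow> y \<in> U) uniformity)"

lemmas unitization_ops = zero_unitization_def one_unitization_def plus_unitization_def
  minus_unitization_def uminus_unitization_def times_unitization_def scaleR_unitization_def
  scaleC_unitization_def

lemma bounded_linear_left_act: "bounded_linear (left_act (u :: 'a unitization))"
proof (rule bounded_linear_intro[where K = "cmod (scalar_part u) + norm (algebra_part u)"])
  fix x y :: 'a and r
  show "left_act u (x + y) = left_act u x + left_act u y"
    by (simp add: left_act_def scaleC_add_right distrib_left)
  show "left_act u (r *\<^sub>R x) = r *\<^sub>R left_act u x"
    by (simp add: left_act_def scaleC_scaleR scaleR_add_right)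
  have "norm (left_act u x) \<le> cmod (scalar_part u) * norm x + norm (algebra_part u) * norm x"
    unfolding left_act_def
    by (intro norm_triangle_le add_mono norm_mult_ineq) (simp add: norm_scaleC)
  then show "norm (left_act u x) \<le> norm x * (cmod (scalar_part u) + norm (algebra_part u))"
    by (simp add: algebra_simps)
qed

lemma onorm_left_act_le:
  "onorm (left_act (u :: 'a unitization)) \<le> cmod (scalar_part u) + norm (algebra_part u)"
proof (rule onorm_bound)
  fix x :: 'a
  have "norm (left_act u x) \<le> cmod (scalar_part u) * norm x + norm (algebra_part u) * norm x"
    unfolding left_act_def
    by (intro norm_triangle_le add_mono norm_mult_ineq) (simp add: norm_scaleC)
  then show "norm (left_act u x) \<le> (cmod (scalar_part u) + norm (algebra_part u)) * norm x"
    by (simp add: algebra_simps)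
qed simp

lemma norm_left_act_le: "norm (left_act u x) \<le> norm u * norm x" for u :: "'a unitization"
proof -
  have "onorm (left_act u) * norm x \<le> norm u * norm x"
    by (rule mult_right_mono) (simp_all add: norm_unitization_def)
  with onorm[OF bounded_linear_left_act, of u x] show ?thesis
    by linarith
qed

lemma norm_le_if_left_act_bound:
  fixes u :: "'a unitization"
  assumes "cmod (scalar_part u) \<le> K" "\<And>x. norm (left_act u x) \<le> K * norm x"
  shows "norm u \<le> K"
  unfolding norm_unitization_def
  using assms order_trans[OF norm_ge_zero assms(1)] by (simp add: onorm_bound)

lemma cmod_scalar_part_le: "cmod (scalar_part u) \<le> norm u" for u :: "'a unitization"
  by (simp add: norm_unitization_def)

text \<open>Letting \<open>u = \<lambda> + a\<close> act on \<open>a\<^sup>\<star>\<close> recovers the norm of \<open>a\<close>, up to the scalar part.\<close>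

lemma norm_algebra_part_le: "norm (algebra_part u) \<le> 2 * norm u" for u :: "'a unitization"
proof (cases "algebra_part u = 0")
  case True
  then show ?thesis
    using order_trans[OF norm_ge_zero cmod_scalar_part_le[of u]] by simp
next
  case False
  let ?a = "algebra_part u"
  have "norm ?a * norm ?a = norm (?a * ?a\<^sup>\<star>)"
    using cstar_identity[of "?a\<^sup>\<star>"] by (simp add: star_star power2_eq_square)
  also have "?a * ?a\<^sup>\<star> = left_act u (?a\<^sup>\<star>) - scalar_part u *\<^sub>C ?a\<^sup>\<star>"
    by (simp add: left_act_def)
  also have "norm \<dots> \<le> norm u * norm ?a + norm u * norm ?a"
  proof (rule order_trans[OF norm_triangle_ineq4] add_mono)+
    show "norm (left_act u (?a\<^sup>\<star>)) \<le> norm u * norm ?a"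
      using norm_left_act_le[of u "?a\<^sup>\<star>"] by simp
    show "norm (scalar_part u *\<^sub>C ?a\<^sup>\<star>) \<le> norm u * norm ?a"
      by (simp add: norm_scaleC mult_right_mono cmod_scalar_part_le)
  qed
  finally have "norm ?a * norm ?a \<le> (2 * norm u) * norm ?a"
    by simp
  with False show ?thesis
    by (simp add: mult_le_cancel_right)
qed

lemma left_act_mult: "left_act (u * v) x = left_act u (left_act v x)" for u :: "'a unitization"
  by (simp add: left_act_def times_unitization_def scaleC_add_right distrib_left distrib_right
      mult_scaleC_left mult_scaleC_right scaleC_scaleC mult.assoc ac_simps)

instance
proof
  fix u v w :: "'a unitization" and r s :: real and c d :: complex
  show "u + v + w = u + (v + w)" "u + v = v + u" "0 + u = u" "- u + u = 0" "u - v = u + - v"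
    by (simp_all add: unitization_ops unitization.expand add.assoc add.commute)
  show "r *\<^sub>R (u + v) = r *\<^sub>R u + r *\<^sub>R v" "(r + s) *\<^sub>R u = r *\<^sub>R u + s *\<^sub>R u"
    "r *\<^sub>R s *\<^sub>R u = (r * s) *\<^sub>R u" "1 *\<^sub>R u = u"
    by (simp_all add: unitization_ops scaleR_add_right scaleR_add_left)
  show "c *\<^sub>C (u + v) = c *\<^sub>C u + c *\<^sub>C v" "(c + d) *\<^sub>C u = c *\<^sub>C u + d *\<^sub>C u"
    "c *\<^sub>C d *\<^sub>C u = (c * d) *\<^sub>C u" "r *\<^sub>R u = complex_of_real r *\<^sub>C u"
    by (simp_all add: unitization_ops scaleC_add_right scaleC_add_left scaleC_scaleC scaleR_scaleC
        distrib_left distrib_right scaleR_conv_of_real mult.assoc)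
  show "u * v * w = u * (v * w)"
    by (simp add: unitization_ops scaleC_add_right distrib_left distrib_right
        mult_scaleC_left mult_scaleC_right scaleC_scaleC mult.assoc ac_simps)
  show "(u + v) * w = u * w + v * w" "u * (v + w) = u * v + u * w"
    by (simp_all add: unitization_ops scaleC_add_right scaleC_add_left distrib_left distrib_right
        ac_simps)
  show "r *\<^sub>R u * v = r *\<^sub>R (u * v)" "u * r *\<^sub>R v = r *\<^sub>R (u * v)"
    by (simp_all add: unitization_ops scaleC_add_right mult_scaleC_left mult_scaleC_right
        scaleC_scaleC scaleR_scaleC scaleR_conv_of_real ac_simps)
  show "1 * u = u" "u * 1 = u" "(0 :: 'a unitization) \<noteq> 1"
    by (simp_all add: unitization_ops)
  show "dist u v = norm (u - v)" "sgn u = inverse (norm u) *\<^sub>R u"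
    "uniformity = (INF e\<in>{0<..}. principal {(u, v :: 'a unitization). dist u v < e})"
    "open U \<longleftrightarrow> (\<forall>x\<in>U. \<forall>\<^sub>F (x', y) in uniformity. x' = x \<longrightarrow> y \<in> U)" for U :: "'a unitization set"
    by (simp_all add: dist_unitization_def sgn_unitization_def uniformity_unitization_def
        open_unitization_def)
  have nonneg: "0 \<le> norm x" for x :: "'a unitization"
    by (rule order_trans[OF norm_ge_zero cmod_scalar_part_le])
  show "norm u = 0 \<longleftrightarrow> u = 0"
  proof
    assume "norm u = 0"
    then show "u = 0"
      using cmod_scalar_part_le[of u] norm_algebra_part_le[of u]
      by (simp add: zero_unitization_def unitization.expand)
  next
    assume "u = 0"
    then have "norm u \<le> 0"
      by (intro norm_le_if_left_act_bound) (simp_all add: zero_unitization_def left_act_def)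
    with nonneg[of u] show "norm u = 0"
      by simp
  qed
  show "norm (u + v) \<le> norm u + norm v"
  proof (rule norm_le_if_left_act_bound)
    show "cmod (scalar_part (u + v)) \<le> norm u + norm v"
      unfolding plus_unitization_def unitization.sel
      by (intro norm_triangle_le add_mono cmod_scalar_part_le)
    fix x :: 'a
    have "left_act (u + v) x = left_act u x + left_act v x"
      by (simp add: left_act_def plus_unitization_def scaleC_add_left distrib_right)
    then show "norm (left_act (u + v) x) \<le> (norm u + norm v) * norm x"
      by (simp add: distrib_right norm_triangle_le add_mono norm_left_act_le)
  qed
  show norm_scaleC: "norm (c *\<^sub>C u) = cmod c * norm u" for c and u :: "'a unitization"
  proof -
    have le: "norm (c *\<^sub>C u) \<le> cmod c * norm u" for c and u :: "'a unitization"
    proof (rule norm_le_if_left_act_bound)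
      show "cmod (scalar_part (c *\<^sub>C u)) \<le> cmod c * norm u"
        by (simp add: scaleC_unitization_def norm_mult mult_left_mono cmod_scalar_part_le)
      fix x :: 'a
      have "left_act (c *\<^sub>C u) x = c *\<^sub>C left_act u x"
        by (simp add: left_act_def scaleC_unitization_def scaleC_add_right scaleC_scaleC
            mult_scaleC_left)
      then show "norm (left_act (c *\<^sub>C u) x) \<le> cmod c * norm u * norm x"
        by (simp add: norm_scaleC mult.assoc mult_left_mono norm_left_act_le)
    qed
    show ?thesis
    proof (cases "c = 0")
      case True
      with le[of c u] nonneg[of "c *\<^sub>C u"] show ?thesis
        by simp
    next
      case False
      have "u = inverse c *\<^sub>C c *\<^sub>C u"
        using False by (simp add: scaleC_unitization_def scaleC_scaleC mult.assoc[symmetric])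
      with le[of "inverse c" "c *\<^sub>C u"] have "norm u \<le> inverse (cmod c) * norm (c *\<^sub>C u)"
        by (simp add: norm_inverse)
      with False have "cmod c * norm u \<le> norm (c *\<^sub>C u)"
        by (simp add: field_simps)
      with le[of c u] show ?thesis
        by simp
    qed
  qed
  have "r *\<^sub>R u = complex_of_real r *\<^sub>C u"
    by (simp add: unitization_ops scaleR_scaleC scaleR_conv_of_real)
  then show "norm (r *\<^sub>R u) = \<bar>r\<bar> * norm u"
    by (simp add: norm_scaleC)
  show "norm (u * v) \<le> norm u * norm v" for u v :: "'a unitization"
  proof (rule norm_le_if_left_act_bound)
    show "cmod (scalar_part (u * v)) \<le> norm u * norm v"
      by (simp add: times_unitization_def norm_mult mult_mono cmod_scalar_part_le nonneg)
    fix x :: 'a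
    have "norm (left_act (u * v) x) \<le> norm u * norm (left_act v x)"
      unfolding left_act_mult by (rule norm_left_act_le)
    also have "\<dots> \<le> norm u * (norm v * norm x)"
      by (intro mult_left_mono norm_left_act_le nonneg)
    finally show "norm (left_act (u * v) x) \<le> norm u * norm v * norm x"
      by (simp add: mult.assoc)
  qed
  have norm_1: "norm (1 :: 'a unitization) \<le> 1"
    by (rule norm_le_if_left_act_bound) (simp_all add: one_unitization_def left_act_def)
  moreover have "1 \<le> norm (1 :: 'a unitization)"
    using cmod_scalar_part_le[of "1 :: 'a unitization"] by (simp add: one_unitization_def)
  ultimately show "norm (1 :: 'a unitization) = 1"
    by simp
qed

end

instantiation unitization :: (cstar_algebra) cstar_algebra
begin

definition "u\<^sup>\<star> = Adjoin (cnj (scalar_part u)) ((algebra_part u)\<^sup>\<star> :: 'a)"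

lemma left_act_adjoint: "(left_act u x)\<^sup>\<star> * y = x\<^sup>\<star> * left_act (u\<^sup>\<star>) y" for u :: "'a unitization"
  by (simp add: left_act_def star_unitization_def star_add star_mult star_scaleC distrib_left
      distrib_right mult_scaleC_left mult_scaleC_right mult.assoc)

text \<open>As for operators on a Hilbert space: \<open>norm (u x)\<^sup>2 = norm (x\<^sup>\<star> (u\<^sup>\<star> u x))\<close>.\<close>

lemma norm_star_mult_ge: "(norm u)\<^sup>2 \<le> norm (u\<^sup>\<star> * u)" for u :: "'a unitization"
proof -
  let ?N = "norm (u\<^sup>\<star> * u)"
  have N: "0 \<le> ?N"
    by (rule order_trans[OF norm_ge_zero cmod_scalar_part_le])
  have "norm u \<le> sqrt ?N"
  proof (rule norm_le_if_left_act_bound)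
    have "(cmod (scalar_part u))\<^sup>2 = cmod (scalar_part (u\<^sup>\<star> * u))"
      by (simp add: times_unitization_def star_unitization_def norm_mult power2_eq_square)
    then show "cmod (scalar_part u) \<le> sqrt ?N"
      by (simp add: real_le_rsqrt cmod_scalar_part_le)
    fix x :: 'a
    have "(norm (left_act u x))\<^sup>2 = norm (x\<^sup>\<star> * left_act (u\<^sup>\<star> * u) x)"
      by (simp only: left_act_mult left_act_adjoint flip: cstar_identity)
    also have "\<dots> \<le> norm x * (?N * norm x)"
      by (rule order_trans[OF norm_mult_ineq]) (simp add: mult_left_mono norm_left_act_le)
    also have "\<dots> = (sqrt ?N * norm x)\<^sup>2"
      using N by (simp add: power_mult_distrib) (simp add: power2_eq_square)
    finally show "norm (left_act u x) \<le> sqrt ?N * norm x"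
      by (rule power2_le_imp_le) (simp add: N)
  qed
  then have "(norm u)\<^sup>2 \<le> (sqrt ?N)\<^sup>2"
    by (rule power_mono) (rule order_trans[OF norm_ge_zero cmod_scalar_part_le])
  with N show ?thesis
    by simp
qed

instance
proof
  fix u v :: "'a unitization" and c :: complex
  show "c *\<^sub>C u * v = c *\<^sub>C (u * v)" "u * c *\<^sub>C v = c *\<^sub>C (u * v)"
    by (simp_all add: unitization_ops scaleC_add_right mult_scaleC_left mult_scaleC_right
        scaleC_scaleC ac_simps)
  show "(u\<^sup>\<star>)\<^sup>\<star> = u" "(u + v)\<^sup>\<star> = u\<^sup>\<star> + v\<^sup>\<star>" "(c *\<^sub>C u)\<^sup>\<star> = cnj c *\<^sub>C u\<^sup>\<star>" "(u * v)\<^sup>\<star> = v\<^sup>\<star> * u\<^sup>\<star>"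
    by (simp_all add: unitization_ops star_unitization_def star_star star_add star_scaleC star_mult ac_simps)
  have le: "norm u \<le> norm (u\<^sup>\<star>)" for u :: "'a unitization"
  proof (cases "norm u = 0")
    case False
    have "norm u * norm u \<le> norm (u\<^sup>\<star>) * norm u"
      using norm_star_mult_ge[of u] norm_mult_ineq[of "u\<^sup>\<star>" u] by (simp add: power2_eq_square)
    with False show ?thesis
      by (simp add: mult_le_cancel_right)
  qed simp
  have "(u\<^sup>\<star>)\<^sup>\<star> = u"
    by (simp add: star_unitization_def star_star)
  with le[of u] le[of "u\<^sup>\<star>"] have "norm (u\<^sup>\<star>) = norm u"
    by simp
  with norm_star_mult_ge[of u] norm_mult_ineq[of "u\<^sup>\<star>" u] show "norm (u\<^sup>\<star> * u) = (norm u)\<^sup>2"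
    by (simp add: power2_eq_square)
next
  fix X :: "nat \<Rightarrow> 'a unitization"
  assume X: "Cauchy X"
  have bound: "norm u \<le> cmod (scalar_part u) + norm (algebra_part u)" for u :: "'a unitization"
    unfolding norm_unitization_def using onorm_left_act_le[of u] by simp
  have cauchy: "\<exists>M. \<forall>m\<ge>M. \<forall>n\<ge>M. norm (X m - X n) < e" if "0 < e" for e
    using metric_CauchyD[OF X that] by (simp add: dist_unitization_def)
  have "Cauchy (\<lambda>n. scalar_part (X n))"
  proof (rule CauchyI)
    fix e :: real
    assume "0 < e"
    then obtain M where M: "\<forall>m\<ge>M. \<forall>n\<ge>M. norm (X m - X n) < e"
      using cauchy by blast
    have "cmod (scalar_part (X m) - scalar_part (X n)) \<le> norm (X m - X n)" for m n
      using cmod_scalar_part_le[of "X m - X n"] by (simp add: minus_unitization_def)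
    with M show "\<exists>M. \<forall>m\<ge>M. \<forall>n\<ge>M. cmod (scalar_part (X m) - scalar_part (X n)) < e"
      by (meson le_less_trans)
  qed
  then obtain l where l: "(\<lambda>n. scalar_part (X n)) \<longlonglongrightarrow> l"
    by (auto simp: Cauchy_convergent_iff convergent_def)
  have "Cauchy (\<lambda>n. algebra_part (X n))"
  proof (rule CauchyI)
    fix e :: real
    assume "0 < e"
    then obtain M where M: "\<forall>m\<ge>M. \<forall>n\<ge>M. norm (X m - X n) < e / 2"
      using cauchy[of "e / 2"] by auto
    have "norm (algebra_part (X m) - algebra_part (X n)) \<le> 2 * norm (X m - X n)" for m n
      using norm_algebra_part_le[of "X m - X n"] by (simp add: minus_unitization_def)
    moreover have "2 * norm (X m - X n) < e" if "m \<ge> M" "n \<ge> M" for m n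
      using M that by (simp add: mult.commute)
    ultimately show "\<exists>M. \<forall>m\<ge>M. \<forall>n\<ge>M. norm (algebra_part (X m) - algebra_part (X n)) < e"
      by (meson le_less_trans)
  qed
  then obtain a where a: "(\<lambda>n. algebra_part (X n)) \<longlonglongrightarrow> a"
    by (auto simp: Cauchy_convergent_iff convergent_def)
  have lim: "(\<lambda>n. cmod (scalar_part (X n) - l) + norm (algebra_part (X n) - a)) \<longlonglongrightarrow> 0"
    using tendsto_add[OF tendsto_norm_zero[OF LIM_zero[OF l]] tendsto_norm_zero[OF LIM_zero[OF a]]]
    by simp
  have le: "norm (X n - Adjoin l a)
      \<le> cmod (scalar_part (X n) - l) + norm (algebra_part (X n) - a)" for n
    using bound[of "X n - Adjoin l a"] by (simp only: minus_unitization_def unitization.sel)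
  have "(\<lambda>n. X n - Adjoin l a) \<longlonglongrightarrow> 0"
    by (rule Lim_null_comparison[OF always_eventually[OF allI[OF le]] lim])
  then have "X \<longlonglongrightarrow> Adjoin l a"
    by (rule LIM_zero_cancel)
  then show "convergent X"
    by (rule convergentI)
qed

end

instance unitization :: (cstar_algebra) unital_cstar_algebra ..

definition to_unitization :: "'a::cstar_algebra \<Rightarrow> 'a unitization" where
  "to_unitization a = Adjoin 0 a"

lemma to_unitization_simps:
  "to_unitization (a + b) = to_unitization a + to_unitization b"
  "to_unitization (c *\<^sub>C a) = c *\<^sub>C to_unitization a"
  "to_unitization (a * b) = to_unitization a * to_unitization b"
  "to_unitization (a\<^sup>\<star>) = (to_unitization a)\<^sup>\<star>"
  by (simp_all add: to_unitization_def unitization_ops star_unitization_def)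

lemma norm_to_unitization [simp]: "norm (to_unitization a) = norm a"
proof (rule order_antisym)
  show "norm (to_unitization a) \<le> norm a"
    by (rule norm_le_if_left_act_bound) (simp_all add: to_unitization_def left_act_def norm_mult_ineq)
  show "norm a \<le> norm (to_unitization a)"
  proof (cases "a = 0")
    case False
    have "norm a * norm a = norm (left_act (to_unitization a) (a\<^sup>\<star>))"
      using cstar_identity[of "a\<^sup>\<star>"]
      by (simp add: to_unitization_def left_act_def star_star power2_eq_square)
    also have "\<dots> \<le> norm (to_unitization a) * norm a"
      using norm_left_act_le[of "to_unitization a" "a\<^sup>\<star>"] by simp
    finally show ?thesis
      using False by (simp add: mult_le_cancel_right)
  qed simp
qed

section \<open>Completion of a positive semidefinite form\<close>

context semi_inner_product
begin

definition scauchy :: "(nat \<Rightarrow> 'v) \<Rightarrow> bool" where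
  "scauchy y \<longleftrightarrow> (\<forall>e>0. \<exists>N. \<forall>m\<ge>N. \<forall>n\<ge>N. snorm (y m - y n) < e)"

text \<open>The limit of a Cauchy sequence \<open>y\<close> is encoded as the functional \<open>x \<mapsto> lim B x (y n)\<close>, that
  is, as its inner products with the elements of the given space. This determines the limit,
  because those elements are dense in the completion.\<close>

definition represents :: "(nat \<Rightarrow> 'v) \<Rightarrow> ('v \<Rightarrow> complex) \<Rightarrow> bool" where
  "represents y F \<longleftrightarrow> scauchy y \<and> (\<forall>x. (\<lambda>n. B x (y n)) \<longlonglongrightarrow> F x)"

definition representative :: "('v \<Rightarrow> complex) \<Rightarrow> nat \<Rightarrow> 'v" where
  "representative F = (SOME y. represents y F)"

definition proj :: "('v \<Rightarrow> complex) \<Rightarrow> 'v \<Rightarrow> complex" where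
  "proj F = (if \<exists>y. represents y F then F else (\<lambda>x. 0))"

text \<open>A \<^locale>\<open>Metric_space\<close> has a distance that is symmetric on the whole type. Addition therefore
  treats functionals outside the carrier as zero.\<close>

definition completion :: "('v \<Rightarrow> complex) hilbert" where
  "completion = \<lparr>carrier = {F. \<exists>y. represents y F}, mult = undefined, one = undefined,
     zero = (\<lambda>x. 0), add = (\<lambda>F G x. proj F x + proj G x), smult = (\<lambda>c F x. c * F x),
     cinner = (\<lambda>F G. lim (\<lambda>n. B (representative F n) (representative G n)))\<rparr>"

lemma completion_simps [simp]:
  "F \<oplus>\<^bsub>completion\<^esub> G = (\<lambda>x. proj F x + proj G x)"
  "c \<odot>\<^bsub>completion\<^esub> F = (\<lambda>x. c * F x)"
  "\<zero>\<^bsub>completion\<^esub> = (\<lambda>x. 0)"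
  by (simp_all add: completion_def)

lemma cinner_completion:
  "cinner completion F G = lim (\<lambda>n. B (representative F n) (representative G n))"
  by (simp add: completion_def)

lemma in_carrier_iff: "F \<in> carrier completion \<longleftrightarrow> (\<exists>y. represents y F)"
  by (simp add: completion_def)

lemma proj_in [simp]: "F \<in> carrier completion \<Longrightarrow> proj F = F"
  by (simp add: proj_def in_carrier_iff)

lemma carrierE:
  assumes "F \<in> carrier completion"
  obtains y where "represents y F"
  using assms by (auto simp: in_carrier_iff)

lemma scauchyI: "(\<And>e. 0 < e \<Longrightarrow> \<exists>N. \<forall>m\<ge>N. \<forall>n\<ge>N. snorm (y m - y n) < e) \<Longrightarrow> scauchy y"
  by (simp add: scauchy_def)

lemma scauchyD: "scauchy y \<Longrightarrow> 0 < e \<Longrightarrow> \<exists>N. \<forall>m\<ge>N. \<forall>n\<ge>N. snorm (y m - y n) < e"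
  by (simp add: scauchy_def)

lemma scauchy_lipschitz:
  assumes y: "scauchy y" and K: "\<And>m n. snorm (z m - z n) \<le> K * snorm (y m - y n)"
  shows "scauchy z"
proof (rule scauchyI)
  fix e :: real
  assume e: "0 < e"
  let ?K = "max K 1"
  have "0 < e / ?K"
    using e by simp
  from scauchyD[OF y this] obtain N where N: "\<forall>m\<ge>N. \<forall>n\<ge>N. snorm (y m - y n) < e / ?K"
    by blast
  have "snorm (z m - z n) < e" if "m \<ge> N" "n \<ge> N" for m n
  proof -
    have "snorm (z m - z n) \<le> ?K * snorm (y m - y n)"
      by (rule order_trans[OF K]) (simp add: mult_right_mono)
    also have "\<dots> < ?K * (e / ?K)"
      using N that by (intro mult_strict_left_mono) auto
    finally show ?thesis
      by simp
  qed
  then show "\<exists>N. \<forall>m\<ge>N. \<forall>n\<ge>N. snorm (z m - z n) < e"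
    by blast
qed

lemma scauchy_scaleC:
  assumes "scauchy y"
  shows "scauchy (\<lambda>n. c *\<^sub>C y n)"
proof (rule scauchy_lipschitz[OF assms])
  fix m n
  show "snorm (c *\<^sub>C y m - c *\<^sub>C y n) \<le> cmod c * snorm (y m - y n)"
    using snorm_scaleC[of c "y m - y n"] by (simp add: scaleC_diff_right)
qed

lemma scauchy_add:
  assumes "scauchy y" "scauchy z"
  shows "scauchy (\<lambda>n. y n + z n)"
proof (rule scauchyI)
  fix e :: real
  assume e: "0 < e"
  then obtain M N where MN: "\<forall>m\<ge>M. \<forall>n\<ge>M. snorm (y m - y n) < e / 2"
    "\<forall>m\<ge>N. \<forall>n\<ge>N. snorm (z m - z n) < e / 2"
    using scauchyD[OF assms(1), of "e / 2"] scauchyD[OF assms(2), of "e / 2"] by auto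
  have "snorm (y m + z m - (y n + z n)) < e" if "m \<ge> max M N" "n \<ge> max M N" for m n
  proof -
    have "snorm (y m - y n) < e / 2" "snorm (z m - z n) < e / 2"
      using MN that by simp_all
    with snorm_triangle[of "y m - y n" "z m - z n"] show ?thesis
      by (simp add: algebra_simps)
  qed
  then show "\<exists>N. \<forall>m\<ge>N. \<forall>n\<ge>N. snorm (y m + z m - (y n + z n)) < e"
    by blast
qed

lemma scauchy_bounded:
  assumes "scauchy y"
  obtains K where "0 < K" "\<And>n. snorm (y n) \<le> K"
proof -
  have "Cauchy (\<lambda>n. snorm (y n))"
  proof (rule CauchyI)
    fix e :: real
    assume "0 < e"
    then obtain N where "\<forall>m\<ge>N. \<forall>n\<ge>N. snorm (y m - y n) < e"
      using scauchyD[OF assms] by blast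
    then show "\<exists>N. \<forall>m\<ge>N. \<forall>n\<ge>N. norm (snorm (y m) - snorm (y n)) < e"
      unfolding real_norm_def by (meson snorm_triangle_sub le_less_trans)
  qed
  then have "Bseq (\<lambda>n. snorm (y n))"
    by (rule Cauchy_Bseq)
  then obtain K where K: "0 < K" "\<And>n. norm (snorm (y n)) \<le> K"
    by (auto simp: Bseq_def)
  show ?thesis
    by (rule that[OF K(1)]) (use K(2) in simp)
qed

text \<open>A Cauchy sequence that converges weakly to zero converges to zero: for fixed large \<open>N\<close>, split
  \<open>B (w n) (w n)\<close> as \<open>B (w n - w N) (w n) + B (w N) (w n)\<close>.\<close>

lemma snorm_tendsto_zero:
  assumes w: "represents w (\<lambda>x. 0)"
  shows "(\<lambda>n. snorm (w n)) \<longlonglongrightarrow> 0"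
proof (rule LIMSEQ_I)
  fix e :: real
  assume e: "0 < e"
  from w have cauchy: "scauchy w" and weak: "\<And>x. (\<lambda>n. B x (w n)) \<longlonglongrightarrow> 0"
    by (simp_all add: represents_def)
  obtain K where K: "0 < K" "\<And>n. snorm (w n) \<le> K"
    using scauchy_bounded[OF cauchy] by blast
  obtain N where N: "\<forall>m\<ge>N. \<forall>n\<ge>N. snorm (w m - w n) < e\<^sup>2 / 2 / K"
    using scauchyD[OF cauchy, of "e\<^sup>2 / 2 / K"] e K(1) by auto
  obtain M where M: "\<forall>n\<ge>M. cmod (B (w N) (w n)) < e\<^sup>2 / 2"
    using LIMSEQ_D[OF weak[of "w N"], of "e\<^sup>2 / 2"] e by auto
  have "norm (snorm (w n) - 0) < e" if n: "n \<ge> max M N" for n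
  proof -
    have "snorm (w n - w N) * snorm (w n) \<le> e\<^sup>2 / 2 / K * K"
      using N n K by (intro mult_mono) (auto intro: less_imp_le)
    then have *: "cmod (B (w n - w N) (w n)) \<le> e\<^sup>2 / 2"
      using Cauchy_Schwarz[of "w n - w N" "w n"] K(1) by simp
    have "(snorm (w n))\<^sup>2 = cmod (B (w n - w N) (w n) + B (w N) (w n))"
      by (simp add: diff_left diagonal_eq norm_power)
    also have "\<dots> < e\<^sup>2 / 2 + e\<^sup>2 / 2"
      using M n by (intro le_less_trans[OF norm_triangle_ineq] add_le_less_mono *) simp
    finally have "(snorm (w n))\<^sup>2 < e\<^sup>2"
      by simp
    then have "snorm (w n) < e"
      by (rule power2_less_imp_less) (use e in simp)
    then show ?thesis
      by simp
  qed
  then show "\<exists>M. \<forall>n\<ge>M. norm (snorm (w n) - 0) < e"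
    by blast
qed

lemma represents_const: "represents (\<lambda>n. v) (\<lambda>x. B x v)"
  by (simp add: represents_def scauchy_def)

lemma represents_add:
  "represents y F \<Longrightarrow> represents z G \<Longrightarrow> represents (\<lambda>n. y n + z n) (\<lambda>x. F x + G x)"
  by (auto simp: represents_def add_right intro: scauchy_add tendsto_add)

lemma represents_scaleC: "represents y F \<Longrightarrow> represents (\<lambda>n. c *\<^sub>C y n) (\<lambda>x. c * F x)"
  by (auto simp: represents_def scaleC_right intro: scauchy_scaleC tendsto_mult_left)

lemma represents_diff:
  "represents y F \<Longrightarrow> represents z G \<Longrightarrow> represents (\<lambda>n. y n - z n) (\<lambda>x. F x - G x)"
  using represents_add[of y F "\<lambda>n. (- 1) *\<^sub>C z n" "\<lambda>x. (- 1) * G x"]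
    represents_scaleC[of z G "- 1"] by simp

lemma convergent_form:
  assumes "scauchy y" "scauchy z"
  shows "convergent (\<lambda>n. B (y n) (z n))"
proof -
  obtain K where K: "0 < K" "\<And>n. snorm (y n) \<le> K"
    using scauchy_bounded[OF assms(1)] by blast
  obtain L where L: "0 < L" "\<And>n. snorm (z n) \<le> L"
    using scauchy_bounded[OF assms(2)] by blast
  have "Cauchy (\<lambda>n. B (y n) (z n))"
  proof (rule CauchyI)
    fix e :: real
    assume e: "0 < e"
    obtain M where M: "\<forall>m\<ge>M. \<forall>n\<ge>M. snorm (y m - y n) < e / 2 / L"
      using scauchyD[OF assms(1), of "e / 2 / L"] e L(1) by auto
    obtain N where N: "\<forall>m\<ge>N. \<forall>n\<ge>N. snorm (z m - z n) < e / 2 / K"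
      using scauchyD[OF assms(2), of "e / 2 / K"] e K(1) by auto
    have "cmod (B (y m) (z m) - B (y n) (z n)) < e" if "m \<ge> max M N" "n \<ge> max M N" for m n
    proof -
      have "cmod (B (y m - y n) (z m)) \<le> snorm (y m - y n) * L"
        by (rule order_trans[OF Cauchy_Schwarz]) (simp add: mult_left_mono L(2))
      also have "\<dots> < e / 2 / L * L"
        using M that L(1) by (intro mult_strict_right_mono) auto
      finally have 1: "cmod (B (y m - y n) (z m)) < e / 2"
        using L(1) by simp
      have "cmod (B (y n) (z m - z n)) \<le> K * snorm (z m - z n)"
        by (rule order_trans[OF Cauchy_Schwarz]) (simp add: mult_right_mono K(2))
      also have "\<dots> < K * (e / 2 / K)"
        using N that K(1) by (intro mult_strict_left_mono) auto
      finally have 2: "cmod (B (y n) (z m - z n)) < e / 2"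
        using K(1) by simp
      have "B (y m) (z m) - B (y n) (z n) = B (y m - y n) (z m) + B (y n) (z m - z n)"
        by (simp add: diff_left diff_right)
      with 1 2 norm_triangle_ineq[of "B (y m - y n) (z m)" "B (y n) (z m - z n)"] show ?thesis
        by simp
    qed
    then show "\<exists>M. \<forall>m\<ge>M. \<forall>n\<ge>M. cmod (B (y m) (z m) - B (y n) (z n)) < e"
      by blast
  qed
  then show ?thesis
    by (rule Cauchy_convergent)
qed

text \<open>The limit of \<open>B (y n) (z n)\<close> depends on \<open>z\<close> only through the functional that it represents, so
  the inner product of the completion does not depend on the chosen representatives.\<close>

lemma form_diff_tendsto_zero:
  assumes "scauchy y" "represents z G" "represents z' G"
  shows "(\<lambda>n. B (y n) (z n) - B (y n) (z' n)) \<longlonglongrightarrow> 0"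
proof -
  obtain K where K: "0 < K" "\<And>n. snorm (y n) \<le> K"
    using scauchy_bounded[OF assms(1)] by blast
  have "(\<lambda>n. snorm (z n - z' n)) \<longlonglongrightarrow> 0"
    using snorm_tendsto_zero represents_diff[OF assms(2,3)] by simp
  from tendsto_mult_right_zero[OF this, of K] show ?thesis
  proof (rule Lim_null_comparison[rotated], intro always_eventually allI)
    fix n
    show "cmod (B (y n) (z n) - B (y n) (z' n)) \<le> K * snorm (z n - z' n)"
      using Cauchy_Schwarz[of "y n" "z n - z' n"] mult_right_mono[OF K(2)[of n], of "snorm (z n - z' n)"]
      by (simp add: diff_right)
  qed
qed

lemma represents_representative: "represents y F \<Longrightarrow> represents (representative F) F"
  unfolding representative_def by (rule someI[of "\<lambda>y. represents y F"])

lemma cinner_tendsto: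
  assumes y: "represents y F" and z: "represents z G"
  shows "(\<lambda>n. B (y n) (z n)) \<longlonglongrightarrow> cinner completion F G"
proof -
  let ?y = "representative F" and ?z = "representative G"
  have y': "represents ?y F" and z': "represents ?z G"
    by (rule represents_representative[OF y], rule represents_representative[OF z])
  have cauchy: "scauchy y" "scauchy ?y" "scauchy ?z"
    using y y' z' by (simp_all add: represents_def)
  have lim: "(\<lambda>n. B (?y n) (?z n)) \<longlonglongrightarrow> cinner completion F G"
    unfolding cinner_completion by (rule convergent_form[OF cauchy(2,3), unfolded convergent_LIMSEQ_iff])
  have "(\<lambda>n. B (?z n) (?y n) - B (?z n) (y n)) \<longlonglongrightarrow> 0"
    by (rule form_diff_tendsto_zero[OF cauchy(3) y' y])
  from tendsto_cnj[OF this] have "(\<lambda>n. B (?y n) (?z n) - B (y n) (?z n)) \<longlonglongrightarrow> 0"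
    by (simp only: complex_cnj_diff complex_cnj_zero hermitian[symmetric])
  from tendsto_diff[OF lim this] have "(\<lambda>n. B (y n) (?z n)) \<longlonglongrightarrow> cinner completion F G"
    by simp
  from tendsto_diff[OF this form_diff_tendsto_zero[OF cauchy(1) z' z]] show ?thesis
    by simp
qed

lemma cinner_eqI:
  "represents y F \<Longrightarrow> represents z G \<Longrightarrow> (\<lambda>n. B (y n) (z n)) \<longlonglongrightarrow> l \<Longrightarrow> cinner completion F G = l"
  using LIMSEQ_unique cinner_tendsto by blast

definition \<iota> :: "'v \<Rightarrow> 'v \<Rightarrow> complex" where
  "\<iota> v = (\<lambda>x. B x v)"

lemma represents_\<iota>: "represents (\<lambda>n. v) (\<iota> v)"
  unfolding \<iota>_def by (rule represents_const)

lemma \<iota>_in_carrier: "\<iota> v \<in> carrier completion"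
  using represents_\<iota> in_carrier_iff by blast

lemma cinner_\<iota>: "cinner completion (\<iota> v) (\<iota> w) = B v w"
  by (rule cinner_eqI[OF represents_\<iota> represents_\<iota>]) simp

lemma hnorm_tendsto: "represents y F \<Longrightarrow> (\<lambda>n. snorm (y n)) \<longlonglongrightarrow> hnorm completion F"
  unfolding snorm_def hnorm_def by (intro tendsto_intros cinner_tendsto)

lemma proj_in_carrier: "proj F \<in> carrier completion"
  using \<iota>_in_carrier[of 0] by (auto simp: proj_def in_carrier_iff \<iota>_def)

lemma add_in_carrier:
  assumes "F \<in> carrier completion" "G \<in> carrier completion"
  shows "(\<lambda>x. F x + G x) \<in> carrier completion"
  using assms represents_add unfolding in_carrier_iff by blast

lemma scale_in_carrier: "F \<in> carrier completion \<Longrightarrow> (\<lambda>x. c * F x) \<in> carrier completion"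
  using represents_scaleC unfolding in_carrier_iff by blast

lemma abelian_group_completion: "abelian_group completion"
proof (rule abelian_groupI)
  show "\<zero>\<^bsub>completion\<^esub> \<in> carrier completion"
    using \<iota>_in_carrier[of 0] by (simp add: \<iota>_def)
  fix F
  assume F: "F \<in> carrier completion"
  from scale_in_carrier[OF this, of "- 1"]
  show "\<exists>G\<in>carrier completion. G \<oplus>\<^bsub>completion\<^esub> F = \<zero>\<^bsub>completion\<^esub>"
    by (intro bexI[of _ "\<lambda>x. - 1 * F x"]) (simp_all add: F)
  from \<iota>_in_carrier[of 0] have "(\<lambda>x. 0) \<in> carrier completion"
    by (simp add: \<iota>_def)
  then show "\<zero>\<^bsub>completion\<^esub> \<oplus>\<^bsub>completion\<^esub> F = F"
    by (simp add: F)
qed (auto simp: add_in_carrier add.assoc add.commute)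

lemma minus_completion: "F \<ominus>\<^bsub>completion\<^esub> G = (\<lambda>x. proj F x - proj G x)"
proof -
  have minus_proj: "(\<lambda>x. - proj G x) \<in> carrier completion"
    using scale_in_carrier[OF proj_in_carrier, of "- 1"] by simp
  have "\<ominus>\<^bsub>completion\<^esub> G = (\<lambda>x. - proj G x)"
    unfolding a_inv_def m_inv_def
  proof (rule the_equality)
    fix K
    assume K: "K \<in> carrier (add_monoid completion) \<and>
      G \<otimes>\<^bsub>add_monoid completion\<^esub> K = \<one>\<^bsub>add_monoid completion\<^esub> \<and>
      K \<otimes>\<^bsub>add_monoid completion\<^esub> G = \<one>\<^bsub>add_monoid completion\<^esub>"
    then have "K \<in> carrier completion"
      by simp
    moreover from K have "(\<lambda>x. proj K x + proj G x) = (\<lambda>x. 0)"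
      by (simp del: proj_in)
    ultimately have "K x + proj G x = 0" for x
      by (simp add: fun_eq_iff)
    then show "K = (\<lambda>x. - proj G x)"
      by (simp add: fun_eq_iff eq_neg_iff_add_eq_0)
  qed (simp add: minus_proj)
  then show ?thesis
    by (simp add: a_minus_def minus_proj)
qed

lemma hdist_tendsto:
  assumes y: "represents y F" and z: "represents z G"
  shows "(\<lambda>n. snorm (y n - z n)) \<longlonglongrightarrow> hdist completion F G"
proof -
  have "F \<in> carrier completion" "G \<in> carrier completion"
    using y z by (auto simp: in_carrier_iff)
  with hnorm_tendsto[OF represents_diff[OF y z]] show ?thesis
    by (simp add: hdist_def minus_completion)
qed

lemma hdist_proj: "hdist completion F G = hdist completion (proj F) (proj G)"
  by (simp add: hdist_def minus_completion proj_in_carrier)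

lemma hdist_\<iota>: "hdist completion (\<iota> v) (\<iota> w) = snorm (v - w)"
  using LIMSEQ_unique[OF hdist_tendsto[OF represents_\<iota>[of v] represents_\<iota>[of w]] tendsto_const] .

lemma Metric_space_completion: "Metric_space (carrier completion) (hdist completion)"
proof
  fix F G
  obtain y z where y: "represents y (proj F)" and z: "represents z (proj G)"
    using proj_in_carrier carrierE by meson
  show "0 \<le> hdist completion F G"
    unfolding hdist_proj[of F G] by (rule LIMSEQ_le_const[OF hdist_tendsto[OF y z]]) simp
  show "hdist completion F G = hdist completion G F"
    unfolding hdist_proj[of F G] hdist_proj[of G F]
    by (rule LIMSEQ_unique[OF hdist_tendsto[OF y z]])
      (subst snorm_minus_commute, rule hdist_tendsto[OF z y])
next
  fix F G
  assume "F \<in> carrier completion" "G \<in> carrier completion"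
  then obtain y z where y: "represents y F" and z: "represents z G"
    by (auto simp: in_carrier_iff)
  show "hdist completion F G = 0 \<longleftrightarrow> F = G"
  proof
    assume "hdist completion F G = 0"
    with hdist_tendsto[OF y z] have "(\<lambda>n. snorm (y n - z n)) \<longlonglongrightarrow> 0"
      by simp
    from tendsto_mult_right_zero[OF this] have lim: "(\<lambda>n. snorm x * snorm (y n - z n)) \<longlonglongrightarrow> 0" for x .
    have "(\<lambda>n. B x (y n - z n)) \<longlonglongrightarrow> 0" for x
      by (rule Lim_null_comparison[OF always_eventually[OF allI] lim[of x]]) (rule Cauchy_Schwarz)
    moreover have "(\<lambda>n. B x (y n - z n)) \<longlonglongrightarrow> F x - G x" for x
      using represents_diff[OF y z] by (simp add: represents_def)
    ultimately have "F x - G x = 0" for x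
      using LIMSEQ_unique by blast
    then show "F = G"
      by (intro ext) simp
  next
    assume "F = G"
    with hdist_tendsto[OF y y] show "hdist completion F G = 0"
      by (simp add: LIMSEQ_const_iff)
  qed
next
  fix F G K
  assume "F \<in> carrier completion" "G \<in> carrier completion" "K \<in> carrier completion"
  then obtain y z w where y: "represents y F" and z: "represents z G" and w: "represents w K"
    by (auto simp: in_carrier_iff)
  show "hdist completion F K \<le> hdist completion F G + hdist completion G K"
    by (rule LIMSEQ_le[OF hdist_tendsto[OF y w]
          tendsto_add[OF hdist_tendsto[OF y z] hdist_tendsto[OF z w]]])
      (simp add: snorm_triangle_diff)
qed

lemma dense_\<iota>:
  assumes "F \<in> carrier completion" "0 < e"
  obtains v where "hdist completion F (\<iota> v) < e"
proof -
  from assms(1) obtain y where y: "represents y F"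
    by (rule carrierE)
  then obtain N where N: "\<forall>m\<ge>N. \<forall>n\<ge>N. snorm (y m - y n) < e / 2"
    using scauchyD[of y "e / 2"] assms(2) by (auto simp: represents_def)
  have "hdist completion F (\<iota> (y N)) \<le> e / 2"
    by (rule LIMSEQ_le_const2[OF hdist_tendsto[OF y represents_\<iota>]])
      (use N in \<open>auto intro!: exI[of _ N] less_imp_le\<close>)
  with assms(2) show ?thesis
    by (intro that[of "y N"]) simp
qed

text \<open>Each member of a Cauchy sequence in the completion is approximated by some \<open>\<iota> (v n)\<close> up to
  \<open>1 / (n + 1)\<close>; then \<open>v\<close> is Cauchy and represents the limit.\<close>

lemma mcomplete_completion: "Metric_space.mcomplete (carrier completion) (hdist completion)"
proof -
  interpret M: Metric_space "carrier completion" "hdist completion"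
    by (rule Metric_space_completion)
  show ?thesis
    unfolding M.mcomplete_def
  proof (intro allI impI)
    fix \<sigma>
    assume \<sigma>: "M.MCauchy \<sigma>"
    then have in_carrier: "\<sigma> n \<in> carrier completion" for n
      by (auto simp: M.MCauchy_def)
    have "\<exists>v. hdist completion (\<sigma> n) (\<iota> v) < 1 / real (Suc n)" for n
      by (rule dense_\<iota>[OF in_carrier[of n], of "1 / real (Suc n)"]) auto
    then obtain v where v: "\<And>n. hdist completion (\<sigma> n) (\<iota> (v n)) < 1 / real (Suc n)"
      by metis
    have small: "\<exists>N. \<forall>n\<ge>N. hdist completion (\<sigma> n) (\<iota> (v n)) < e" if e: "0 < e" for e
    proof -
      obtain N where N: "1 / real (Suc N) < e"
        using reals_Archimedean[OF e] unfolding inverse_eq_divide by blast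
      have "hdist completion (\<sigma> n) (\<iota> (v n)) < e" if "n \<ge> N" for n
      proof -
        have "1 / real (Suc n) \<le> 1 / real (Suc N)"
          using that by (intro divide_left_mono) simp_all
        with v[of n] N show ?thesis
          by linarith
      qed
      then show ?thesis
        by blast
    qed
    have cauchy: "scauchy v"
    proof (rule scauchyI)
      fix e :: real
      assume e: "0 < e"
      obtain M where M: "\<And>m n. M \<le> m \<Longrightarrow> M \<le> n \<Longrightarrow> hdist completion (\<sigma> m) (\<sigma> n) < e / 3"
        using \<sigma> e unfolding M.MCauchy_def by (metis divide_pos_pos zero_less_numeral)
      obtain N where N: "\<And>n. N \<le> n \<Longrightarrow> hdist completion (\<sigma> n) (\<iota> (v n)) < e / 3"
        using small[of "e / 3"] e by auto
      have "snorm (v m - v n) < e" if "m \<ge> max M N" "n \<ge> max M N" for m n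
      proof -
        have "hdist completion (\<iota> (v m)) (\<iota> (v n))
            \<le> hdist completion (\<iota> (v m)) (\<sigma> m) + hdist completion (\<sigma> m) (\<iota> (v n))"
          by (intro M.triangle \<iota>_in_carrier in_carrier)
        moreover have "hdist completion (\<sigma> m) (\<iota> (v n))
            \<le> hdist completion (\<sigma> m) (\<sigma> n) + hdist completion (\<sigma> n) (\<iota> (v n))"
          by (intro M.triangle \<iota>_in_carrier in_carrier)
        ultimately show ?thesis
          using M[of m n] N[of m] N[of n] that M.commute[of "\<iota> (v m)" "\<sigma> m"] by (simp add: hdist_\<iota>)
      qed
      then show "\<exists>N. \<forall>m\<ge>N. \<forall>n\<ge>N. snorm (v m - v n) < e"
        by blast
    qed
    define F where "F x = lim (\<lambda>n. B x (v n))" for x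
    have F: "represents v F"
    proof -
      have "(\<lambda>n. B x (v n)) \<longlonglongrightarrow> F x" for x
        using convergent_form[OF _ cauchy, of "\<lambda>n. x"]
        unfolding convergent_LIMSEQ_iff F_def by (simp add: scauchy_def)
      with cauchy show ?thesis
        by (simp add: represents_def)
    qed
    then have F_in: "F \<in> carrier completion"
      by (auto simp: in_carrier_iff)
    have "\<exists>N. \<forall>n\<ge>N. hdist completion (\<sigma> n) F < e" if e: "0 < e" for e
    proof -
      obtain M where M: "\<forall>m\<ge>M. \<forall>n\<ge>M. snorm (v m - v n) < e / 3"
        using scauchyD[OF cauchy, of "e / 3"] e by auto
      obtain N where N: "\<And>n. N \<le> n \<Longrightarrow> hdist completion (\<sigma> n) (\<iota> (v n)) < e / 3"
        using small[of "e / 3"] e by auto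
      have "hdist completion (\<sigma> n) F < e" if "n \<ge> max M N" for n
      proof -
        have "hdist completion (\<iota> (v n)) F \<le> e / 3"
          by (rule LIMSEQ_le_const2[OF hdist_tendsto[OF represents_\<iota> F]])
            (use M that in \<open>auto intro!: exI[of _ M] less_imp_le\<close>)
        moreover have "hdist completion (\<sigma> n) F
            \<le> hdist completion (\<sigma> n) (\<iota> (v n)) + hdist completion (\<iota> (v n)) F"
          by (intro M.triangle \<iota>_in_carrier in_carrier F_in)
        ultimately show ?thesis
          using N[of n] that e by simp
      qed
      then show ?thesis
        by blast
    qed
    then show "\<exists>F. limitin M.mtopology \<sigma> F sequentially"
      unfolding M.limit_metric_sequentially using F_in in_carrier
      by (intro exI[of _ F]) simp
  qed
qed

lemma cring_complex_ring: "cring complex_ring"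
proof (rule cringI)
  show "abelian_group complex_ring"
    by (rule abelian_groupI) (auto simp: complex_ring_def intro: exI[of _ "- x" for x] add.left_inverse)
  show "comm_monoid complex_ring"
    by (rule comm_monoidI) (simp_all add: complex_ring_def)
qed (simp add: complex_ring_def distrib_right)

theorem hilbert_space_completion: "hilbert_space completion"
proof -
  have "module complex_ring completion"
  proof (rule moduleI[OF cring_complex_ring abelian_group_completion])
    fix c d and F G
    assume F: "F \<in> carrier completion" and G: "G \<in> carrier completion"
    show "c \<odot>\<^bsub>completion\<^esub> F \<in> carrier completion"
      using scale_in_carrier[OF F] by simp
    show "(c \<oplus>\<^bsub>complex_ring\<^esub> d) \<odot>\<^bsub>completion\<^esub> F
        = c \<odot>\<^bsub>completion\<^esub> F \<oplus>\<^bsub>completion\<^esub> d \<odot>\<^bsub>completion\<^esub> F"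
      using scale_in_carrier[OF F] by (simp add: complex_ring_def distrib_right)
    show "c \<odot>\<^bsub>completion\<^esub> (F \<oplus>\<^bsub>completion\<^esub> G)
        = c \<odot>\<^bsub>completion\<^esub> F \<oplus>\<^bsub>completion\<^esub> c \<odot>\<^bsub>completion\<^esub> G"
      using scale_in_carrier[OF F] scale_in_carrier[OF G] F G by (simp add: distrib_left)
    show "(c \<otimes>\<^bsub>complex_ring\<^esub> d) \<odot>\<^bsub>completion\<^esub> F = c \<odot>\<^bsub>completion\<^esub> (d \<odot>\<^bsub>completion\<^esub> F)"
      by (simp add: complex_ring_def mult.assoc)
    show "\<one>\<^bsub>complex_ring\<^esub> \<odot>\<^bsub>completion\<^esub> F = F"
      by (simp add: complex_ring_def)
  qed
  then show ?thesis
  proof (rule hilbert_space.intro)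
    show "hilbert_space_axioms completion"
    proof
      fix F G K c
      assume "F \<in> carrier completion" "G \<in> carrier completion" "K \<in> carrier completion"
      then obtain y z w where y: "represents y F" and z: "represents z G" and w: "represents w K"
        and in_carrier: "G \<in> carrier completion" "K \<in> carrier completion"
        by (auto simp: in_carrier_iff)
      show "cinner completion F (G \<oplus>\<^bsub>completion\<^esub> K) = cinner completion F G + cinner completion F K"
        using cinner_eqI[OF y represents_add[OF z w]]
          tendsto_add[OF cinner_tendsto[OF y z] cinner_tendsto[OF y w]]
        by (simp add: in_carrier add_right)
    next
      fix F G c
      assume "F \<in> carrier completion" "G \<in> carrier completion"
      then obtain y z where y: "represents y F" and z: "represents z G"
        by (auto simp: in_carrier_iff)
      show "cinner completion F (c \<odot>\<^bsub>completion\<^esub> G) = c * cinner completion F G"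
        using cinner_eqI[OF y represents_scaleC[OF z]] tendsto_mult_left[OF cinner_tendsto[OF y z]]
        by (simp add: scaleC_right)
      show "cinner completion F G = cnj (cinner completion G F)"
        by (rule cinner_eqI[OF y z]) (subst hermitian, intro tendsto_cnj cinner_tendsto y z)
    next
      fix F
      assume "F \<in> carrier completion"
      then obtain y where y: "represents y F"
        by (rule carrierE)
      show "cinner completion F F \<in> \<real>\<^sub>\<ge>\<^sub>0"
        by (rule Lim_in_closed_set[OF closed_nonneg_Reals_complex _ _ cinner_tendsto[OF y y]])
          (simp_all add: nonneg)
      assume "cinner completion F F = 0"
      then have "(\<lambda>n. snorm (y n)) \<longlonglongrightarrow> 0"
        using hnorm_tendsto[OF y] by (simp add: hnorm_def)
      from tendsto_mult_right_zero[OF this] have lim: "(\<lambda>n. snorm x * snorm (y n)) \<longlonglongrightarrow> 0" for x .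
      have "(\<lambda>n. B x (y n)) \<longlonglongrightarrow> 0" for x
        by (rule Lim_null_comparison[OF always_eventually[OF allI] lim[of x]]) (rule Cauchy_Schwarz)
      then have "F x = 0" for x
        using y LIMSEQ_unique unfolding represents_def by blast
      then show "F = \<zero>\<^bsub>completion\<^esub>"
        by (simp add: fun_eq_iff)
    qed (rule mcomplete_completion)
  qed
qed

end

section \<open>The representation of a positive functional\<close>

context positive_functional
begin

text \<open>On the functionals \<open>F x = (x | \<eta>)\<close> that encode vectors \<open>\<eta>\<close>, the operator \<open>a\<close> acts by
  \<open>(x | a \<eta>) = (a\<^sup>\<star> x | \<eta>)\<close>.\<close>

definition gns :: "'a \<Rightarrow> ('a \<Rightarrow> complex) \<Rightarrow> 'a \<Rightarrow> complex" where
  "gns a F = (\<lambda>x. F (a\<^sup>\<star> * x))"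

lemma represents_gns:
  assumes "form.represents y F"
  shows "form.represents (\<lambda>n. a * y n) (gns a F)"
  unfolding form.represents_def
proof (intro conjI allI)
  from assms have y: "form.scauchy y" and lim: "\<And>x. (\<lambda>n. \<phi> (x\<^sup>\<star> * y n)) \<longlonglongrightarrow> F x"
    by (simp_all add: form.represents_def)
  show "form.scauchy (\<lambda>n. a * y n)"
    by (rule form.scauchy_lipschitz[OF y, where K = "norm a"]) (simp add: snorm_mult_le flip: right_diff_distrib)
  show "(\<lambda>n. \<phi> (x\<^sup>\<star> * (a * y n))) \<longlonglongrightarrow> gns a F x" for x
    using lim[of "a\<^sup>\<star> * x"] by (simp add: gns_def star_mult star_star mult.assoc)
qed

lemma gns_\<iota>: "gns a (form.\<iota> v) = form.\<iota> (a * v)"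
  by (simp add: gns_def form.\<iota>_def star_mult star_star mult.assoc)

lemma gns_in_carrier: "F \<in> carrier form.completion \<Longrightarrow> gns a F \<in> carrier form.completion"
  using represents_gns unfolding form.in_carrier_iff by blast

lemma
  assumes "F \<in> carrier form.completion"
  shows carrier_add: "F (x + y) = F x + F y"
    and carrier_scaleC: "F (c *\<^sub>C x) = cnj c * F x"
proof -
  from assms obtain y where y: "form.represents y F"
    by (rule form.carrierE)
  then have lim: "(\<lambda>n. \<phi> (x\<^sup>\<star> * y n)) \<longlonglongrightarrow> F x" for x
    by (simp add: form.represents_def)
  show "F (u + v) = F u + F v" for u v
    using LIMSEQ_unique[OF lim[of "u + v"]] tendsto_add[OF lim[of u] lim[of v]]
    by (simp add: form.add_left)
  show "F (c *\<^sub>C u) = cnj c * F u" for u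
    using LIMSEQ_unique[OF lim[of "c *\<^sub>C u"]] tendsto_mult_left[OF lim[of u], of "cnj c"]
    by (simp add: form.scaleC_left)
qed

theorem representation_gns: "representation form.completion gns"
  unfolding representation_def
proof (intro conjI allI ballI)
  fix a
  have "hnorm form.completion (gns a F) \<le> norm a * hnorm form.completion F"
    if F: "F \<in> carrier form.completion" for F
  proof -
    from F obtain y where y: "form.represents y F"
      by (rule form.carrierE)
    show ?thesis
      by (rule LIMSEQ_le[OF form.hnorm_tendsto[OF represents_gns[OF y]]
            tendsto_mult_left[OF form.hnorm_tendsto[OF y]]]) (simp add: snorm_mult_le)
  qed
  moreover have "gns a (F \<oplus>\<^bsub>form.completion\<^esub> G)
      = gns a F \<oplus>\<^bsub>form.completion\<^esub> gns a G"
    if "F \<in> carrier form.completion" "G \<in> carrier form.completion" for F G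
    using that by (simp add: gns_in_carrier) (simp add: gns_def)
  ultimately show "gns a \<in> bounded_operators form.completion"
    unfolding bounded_operators_def by (auto simp: gns_in_carrier) (simp add: gns_def)
  show "adjoint_of form.completion (gns (a\<^sup>\<star>)) (gns a)"
    unfolding adjoint_of_def
  proof (intro ballI)
    fix F G
    assume "F \<in> carrier form.completion" "G \<in> carrier form.completion"
    then obtain y z where y: "form.represents y F" and z: "form.represents z G"
      by (auto simp: form.in_carrier_iff)
    have "(\<lambda>n. \<phi> ((y n)\<^sup>\<star> * (a * z n))) \<longlonglongrightarrow> cinner form.completion F (gns a G)"
      by (rule form.cinner_tendsto[OF y represents_gns[OF z]])
    then show "cinner form.completion (gns (a\<^sup>\<star>) F) G = cinner form.completion F (gns a G)"
      by (intro form.cinner_eqI[OF represents_gns[OF y] z])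
        (simp add: star_mult star_star mult.assoc)
  qed
next
  fix a b c F
  assume F: "F \<in> carrier form.completion"
  show "gns (a + b) F = gns a F \<oplus>\<^bsub>form.completion\<^esub> gns b F"
    using F by (simp add: gns_in_carrier)
      (simp add: gns_def star_add distrib_right carrier_add)
  show "gns (c *\<^sub>C a) F = c \<odot>\<^bsub>form.completion\<^esub> gns a F"
    using F by (simp add: gns_def star_scaleC mult_scaleC_left carrier_scaleC)
  show "gns (a * b) F = gns a (gns b F)"
    by (simp add: gns_def star_mult mult.assoc)
qed

end

section \<open>Norm parallelism\<close>

lemma (in positive_functional) snorm_le_norm:
  assumes "\<And>x. cmod (\<phi> x) \<le> norm x"
  shows "form.snorm x \<le> norm x"
proof (rule power2_le_imp_le)
  have "(form.snorm x)\<^sup>2 \<le> cmod (\<phi> (x\<^sup>\<star> * x))"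
    unfolding form.snorm_power2 by (rule complex_Re_le_cmod)
  also have "\<dots> \<le> (norm x)\<^sup>2"
    using assms[of "x\<^sup>\<star> * x"] by (simp add: cstar_identity)
  finally show "(form.snorm x)\<^sup>2 \<le> (norm x)\<^sup>2" .
qed simp

lemma norm_parallel_if_state:
  assumes state: "state \<phi>" and \<alpha>: "cmod \<alpha> = 1"
    and eq: "\<phi> (a\<^sup>\<star> * b) = \<alpha> * of_real (norm a * norm b)"
  shows "norm_parallel a b"
proof -
  from state have linear: "bounded_linear \<phi>" and onorm_1: "onorm \<phi> = 1"
    by (simp_all add: state_def)
  interpret positive_functional \<phi>
    using state linear_add[OF bounded_linear.linear[OF linear]]
    by unfold_locales (auto simp: state_def Defs.positive_def)
  show ?thesis
  proof (rule norm_parallel_if_extremal)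
    show "form.snorm x \<le> norm x" for x
      using onorm[OF linear] by (intro snorm_le_norm) (simp add: onorm_1)
    show "cmod (\<phi> (a\<^sup>\<star> * b)) = norm a * norm b"
      by (simp add: eq norm_mult \<alpha>)
  qed
qed

context hilbert_space
begin

lemma cinner_add_left:
  "\<lbrakk>x \<in> carrier H; y \<in> carrier H; z \<in> carrier H\<rbrakk>
    \<Longrightarrow> cinner H (x \<oplus> y) z = cinner H x z + cinner H y z"
  using cinner_commute[of "x \<oplus> y" z] cinner_commute[of x z] cinner_commute[of y z]
  by (simp add: cinner_add_right)

lemma smult_in_carrier: "x \<in> carrier H \<Longrightarrow> c \<odot>\<^bsub>H\<^esub> x \<in> carrier H"
  by (rule smult_closed) (simp_all add: complex_ring_def)

lemma cinner_smult_left: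
  "\<lbrakk>x \<in> carrier H; y \<in> carrier H\<rbrakk> \<Longrightarrow> cinner H (c \<odot>\<^bsub>H\<^esub> x) y = cnj c * cinner H x y"
  using cinner_commute[of "c \<odot>\<^bsub>H\<^esub> x" y] cinner_commute[of x y]
  by (simp add: cinner_smult_right smult_in_carrier)

text \<open>A vector state of the representation is extended to the unitization by the values
  \<open>(\<xi> | (\<lambda> + \<pi> a) \<xi>)\<close>. There the unit has seminorm one, so \<open>snorm_mult_le\<close> bounds the seminorm of
  every element by its norm; this is the contractivity of representations.\<close>

lemma norm_parallel_if_representation:
  fixes a b :: "'a::cstar_algebra"
  assumes "parallel_in_representation H a b"
  shows "norm_parallel a b"
proof -
  from assms obtain \<pi> \<xi> \<alpha> where rep: "representation H \<pi>" and \<xi>: "\<xi> \<in> carrier H" "hnorm H \<xi> = 1"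
    and \<alpha>: "cmod \<alpha> = 1" and eq: "cinner H (\<pi> a \<xi>) (\<pi> b \<xi>) = \<alpha> * of_real (norm a * norm b)"
    unfolding parallel_in_representation_def by blast
  have cinner_\<xi>: "cinner H \<xi> \<xi> = 1"
    using cinner_nonneg[OF \<xi>(1)] \<xi>(2)
    by (simp add: hnorm_def complex_nonneg_Reals_iff complex_eq_iff)
  have \<pi>_in: "\<pi> x \<xi> \<in> carrier H" for x
    using rep \<xi>(1) by (auto simp: representation_def bounded_operators_def)
  have \<pi>_add: "\<pi> (x + y) \<xi> = \<pi> x \<xi> \<oplus> \<pi> y \<xi>" and \<pi>_scaleC: "\<pi> (c *\<^sub>C x) \<xi> = c \<odot>\<^bsub>H\<^esub> \<pi> x \<xi>"
    and \<pi>_mult: "\<pi> (x * y) \<xi> = \<pi> x (\<pi> y \<xi>)" for x y c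
    using rep \<xi>(1) by (simp_all add: representation_def)
  have adjoint: "cinner H u (\<pi> x v) = cinner H (\<pi> (x\<^sup>\<star>) u) v"
    if "u \<in> carrier H" "v \<in> carrier H" for u v x
    using rep that by (simp add: representation_def adjoint_of_def)
  define \<psi> where "\<psi> u = scalar_part u + cinner H \<xi> (\<pi> (algebra_part u) \<xi>)" for u
  have \<psi>_star_mult: "\<psi> (u\<^sup>\<star> * v) = cinner H (scalar_part u \<odot>\<^bsub>H\<^esub> \<xi> \<oplus> \<pi> (algebra_part u) \<xi>)
      (scalar_part v \<odot>\<^bsub>H\<^esub> \<xi> \<oplus> \<pi> (algebra_part v) \<xi>)" for u v
  proof -
    have 1: "cinner H \<xi> (\<pi> ((algebra_part u)\<^sup>\<star> * algebra_part v) \<xi>)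
        = cinner H (\<pi> (algebra_part u) \<xi>) (\<pi> (algebra_part v) \<xi>)"
      by (simp add: \<pi>_mult adjoint \<xi>(1) \<pi>_in star_star)
    have 2: "cinner H \<xi> (\<pi> ((algebra_part u)\<^sup>\<star>) \<xi>) = cinner H (\<pi> (algebra_part u) \<xi>) \<xi>"
      by (simp add: adjoint \<xi>(1) star_star)
    show ?thesis
      by (simp add: \<psi>_def times_unitization_def star_unitization_def \<pi>_add \<pi>_scaleC 1 2
          cinner_add_right cinner_add_left cinner_smult_right cinner_smult_left \<pi>_in \<xi>(1)
          smult_in_carrier cinner_\<xi> algebra_simps)
  qed
  interpret \<psi>: positive_functional \<psi>
  proof
    fix u v :: "'a unitization" and c
    show "\<psi> (u + v) = \<psi> u + \<psi> v"
      by (simp add: \<psi>_def plus_unitization_def \<pi>_add cinner_add_right \<xi>(1) \<pi>_in)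
    show "\<psi> (c *\<^sub>C u) = c * \<psi> u"
      by (simp add: \<psi>_def scaleC_unitization_def \<pi>_scaleC cinner_smult_right \<xi>(1) \<pi>_in
          distrib_left)
    show "\<psi> (u\<^sup>\<star> * u) \<in> \<real>\<^sub>\<ge>\<^sub>0"
      unfolding \<psi>_star_mult by (intro cinner_nonneg a_closed smult_in_carrier \<xi>(1) \<pi>_in)
  qed
  have \<psi>_to_unitization: "\<psi> (to_unitization x) = cinner H \<xi> (\<pi> x \<xi>)" for x
    by (simp add: \<psi>_def to_unitization_def)
  have "\<psi> 1 = 1"
    using \<psi>.scaleC[of 0] by (simp add: \<psi>_def one_unitization_def zero_unitization_def
        scaleC_unitization_def)
  then have "\<psi>.form.snorm 1 = 1"
    by (simp add: \<psi>.form.snorm_def)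
  have "norm_parallel (to_unitization a) (to_unitization b)"
  proof (rule \<psi>.norm_parallel_if_extremal)
    show "\<psi>.form.snorm u \<le> norm u" for u
      using \<psi>.snorm_mult_le[of u 1] by (simp add: \<open>\<psi>.form.snorm 1 = 1\<close>)
    have "\<psi> ((to_unitization a)\<^sup>\<star> * to_unitization b) = cinner H (\<pi> a \<xi>) (\<pi> b \<xi>)"
      by (simp add: \<psi>_to_unitization \<pi>_mult adjoint \<xi>(1) \<pi>_in star_star flip: to_unitization_simps)
    then show "cmod (\<psi> ((to_unitization a)\<^sup>\<star> * to_unitization b)) = norm (to_unitization a) * norm (to_unitization b)"
      by (simp add: eq norm_mult \<alpha>)
  qed
  then show ?thesis
    by (simp add: norm_parallel_def flip: to_unitization_simps)
qed

end

lemma (in positive_functional) extremal_if_snorm_attained: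
  assumes square_le: "\<And>x. form.snorm x \<le> norm x" and \<alpha>: "cmod \<alpha> = 1"
    and attained: "form.snorm (a + \<alpha> *\<^sub>C b) = norm a + norm b"
  shows "form.snorm a = norm a" and "\<phi> (a\<^sup>\<star> * b) = cnj \<alpha> * of_real (norm a * norm b)"
proof -
  have "norm a + norm b \<le> form.snorm a + form.snorm b"
    using form.snorm_triangle[of a "\<alpha> *\<^sub>C b"] attained by (simp add: form.snorm_scaleC \<alpha>)
  then have a: "form.snorm a = norm a" and b: "form.snorm b = norm b"
    using square_le[of a] square_le[of b] by linarith+
  from a show "form.snorm a = norm a" .
  let ?z = "\<alpha> * \<phi> (a\<^sup>\<star> * b)" and ?r = "norm a * norm b"
  have "(norm a + norm b)\<^sup>2 = (norm a)\<^sup>2 + (norm b)\<^sup>2 + 2 * Re ?z"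
    using form.snorm_add_power2[of a "\<alpha> *\<^sub>C b"]
    by (simp add: attained form.snorm_scaleC \<alpha> a b form.scaleC_right del: times_complex.sel)
  then have re: "Re ?z = ?r"
    by (simp add: power2_sum del: times_complex.sel)
  have "cmod ?z \<le> ?r"
    using form.Cauchy_Schwarz[of a b] by (simp add: norm_mult \<alpha> a b)
  then have "(cmod ?z)\<^sup>2 \<le> ?r\<^sup>2"
    by (rule power_mono) simp
  then have "Im ?z = 0"
    unfolding cmod_power2 re by simp
  with re have "?z = of_real ?r"
    by (intro complex_eqI) (simp_all only: Re_complex_of_real Im_complex_of_real)
  then have "cnj \<alpha> * \<alpha> * \<phi> (a\<^sup>\<star> * b) = cnj \<alpha> * of_real ?r"
    by (simp only: mult.assoc)
  moreover have "cnj \<alpha> * \<alpha> = 1"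
    using complex_norm_square[of \<alpha>] \<alpha> by (simp add: mult.commute)
  ultimately show "\<phi> (a\<^sup>\<star> * b) = cnj \<alpha> * of_real ?r"
    by simp
qed

lemma positive_functional_to_unitization:
  "positive_functional \<psi> \<Longrightarrow> positive_functional (\<lambda>x. \<psi> (to_unitization x))"
  unfolding positive_functional_def by (simp add: to_unitization_simps)

lemma state_to_unitization:
  assumes \<psi>: "positive_functional \<psi>" and le: "\<And>u. cmod (\<psi> u) \<le> norm u"
    and c: "c \<noteq> 0" "\<psi> (to_unitization (c\<^sup>\<star> * c)) = of_real ((norm c)\<^sup>2)"
  shows "state (\<lambda>x. \<psi> (to_unitization x))"
proof -
  interpret positive_functional "\<lambda>x. \<psi> (to_unitization x)"
    by (rule positive_functional_to_unitization[OF \<psi>])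
  have bounded: "bounded_linear (\<lambda>x. \<psi> (to_unitization x))"
  proof (rule bounded_linear_intro[where K = 1])
    show "norm (\<psi> (to_unitization x)) \<le> norm x * 1" for x
      using le[of "to_unitization x"] by simp
  qed (simp_all add: add scaleR scaleR_conv_of_real)
  have "onorm (\<lambda>x. \<psi> (to_unitization x)) = 1"
  proof (rule order_antisym)
    show "onorm (\<lambda>x. \<psi> (to_unitization x)) \<le> 1"
      by (rule onorm_bound) (use le[of "to_unitization x" for x] in simp_all)
    have "(norm c)\<^sup>2 \<le> onorm (\<lambda>x. \<psi> (to_unitization x)) * (norm c)\<^sup>2"
      using onorm[OF bounded, of "c\<^sup>\<star> * c"] by (simp add: c(2) cstar_identity norm_power)
    with c(1) show "1 \<le> onorm (\<lambda>x. \<psi> (to_unitization x))"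
      by (simp add: mult_le_cancel_right1)
  qed
  with bounded show ?thesis
    by (auto simp: state_def scaleC Defs.positive_def intro: positive)
qed

text \<open>The functional is taken to attain the norm of \<open>(a + \<alpha> b)\<^sup>\<star> (a + \<alpha> b)\<close>, where \<open>\<alpha>\<close> witnesses
  the parallelism. If \<open>a = b = 0\<close>, any nonzero element serves.\<close>

lemma exists_extremal_functional:
  fixes a b :: "'a::cstar_algebra"
  assumes "norm_parallel a b" and nonzero: "\<exists>x::'a. x \<noteq> 0"
  obtains \<psi> and c :: 'a and \<alpha> where "positive_functional \<psi>" "\<And>u. cmod (\<psi> u) \<le> norm u" "\<psi> 1 = 1"
    "c \<noteq> 0" "\<psi> (to_unitization (c\<^sup>\<star> * c)) = of_real ((norm c)\<^sup>2)"
    "\<psi> (to_unitization (a\<^sup>\<star> * a)) = of_real ((norm a)\<^sup>2)"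
    "cmod \<alpha> = 1" "\<psi> (to_unitization (a\<^sup>\<star> * b)) = \<alpha> * of_real (norm a * norm b)"
proof -
  from assms(1) obtain \<beta> where \<beta>: "cmod \<beta> = 1" "norm (a + \<beta> *\<^sub>C b) = norm a + norm b"
    by (auto simp: norm_parallel_def)
  obtain c where c: "c \<noteq> 0" "a \<noteq> 0 \<or> b \<noteq> 0 \<Longrightarrow> c = a + \<beta> *\<^sub>C b"
  proof (cases "a = 0 \<and> b = 0")
    case True
    with nonzero that show ?thesis
      by blast
  next
    case False
    then have "norm a + norm b \<noteq> 0"
      by (auto simp: add_nonneg_eq_0_iff)
    with \<beta>(2) have "a + \<beta> *\<^sub>C b \<noteq> 0"
      by (metis norm_zero)
    then show ?thesis
      by (rule that) simp
  qed
  from c(1) have "to_unitization c \<noteq> 0"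
    by (metis norm_to_unitization norm_eq_zero)
  then obtain \<psi> where \<psi>: "positive_functional \<psi>" "\<And>u. cmod (\<psi> u) \<le> norm u" "\<psi> 1 = 1"
    and "\<psi> ((to_unitization c)\<^sup>\<star> * to_unitization c) = of_real ((norm (to_unitization c))\<^sup>2)"
    by (rule exists_norming_positive_functional) blast
  then have norming: "\<psi> (to_unitization (c\<^sup>\<star> * c)) = of_real ((norm c)\<^sup>2)"
    by (simp add: to_unitization_simps)
  interpret positive_functional "\<lambda>x. \<psi> (to_unitization x)"
    by (rule positive_functional_to_unitization[OF \<psi>(1)])
  have square_le: "form.snorm x \<le> norm x" for x
    by (rule snorm_le_norm) (use \<psi>(2)[of "to_unitization x" for x] in simp)
  have "\<psi> (to_unitization (a\<^sup>\<star> * a)) = of_real ((norm a)\<^sup>2)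
      \<and> \<psi> (to_unitization (a\<^sup>\<star> * b)) = cnj \<beta> * of_real (norm a * norm b)"
  proof (cases "a = 0 \<and> b = 0")
    case True
    then show ?thesis
      using form.zero_right[of 0] by simp
  next
    case False
    then have "form.snorm (a + \<beta> *\<^sub>C b) = norm a + norm b"
      using norming c(2) \<beta>(2) by (auto simp: form.snorm_def)
    note extremal_if_snorm_attained[OF square_le \<beta>(1) this]
    then show ?thesis
      using form.diagonal_eq[of a] by simp
  qed
  with that[OF \<psi> c(1) norming, of "cnj \<beta>"] \<beta>(1) show ?thesis
    by simp
qed

text \<open>The GNS representation of \<open>\<psi>\<close> has the unit as cyclic vector, but in the completion of the
  algebra without unit that vector need not come from an element. Here it does: with
  \<open>h = c\<^sup>\<star> c / norm c\<^sup>2\<close>, the element \<open>1 - h\<close> has seminorm zero, since \<open>\<psi> h = 1\<close> and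
  \<open>\<psi> (h\<^sup>2) \<le> 1\<close>.\<close>

lemma exists_unit_mod_kernel:
  fixes c :: "'a::cstar_algebra"
  assumes \<psi>: "positive_functional \<psi>" and le: "\<And>u. cmod (\<psi> u) \<le> norm u" and one: "\<psi> 1 = 1"
    and c: "c \<noteq> 0" "\<psi> (to_unitization (c\<^sup>\<star> * c)) = of_real ((norm c)\<^sup>2)"
  obtains h where "\<psi> (to_unitization h) = 1" "\<And>x. \<psi> (to_unitization (h\<^sup>\<star> * x)) = \<psi> (to_unitization x)"
    "\<And>x. \<psi> (to_unitization (x * h)) = \<psi> (to_unitization x)"
proof -
  interpret positive_functional \<psi>
    by (rule \<psi>)
  define h where "h = complex_of_real (inverse ((norm c)\<^sup>2)) *\<^sub>C (c\<^sup>\<star> * c)"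
  have h: "h\<^sup>\<star> = h"
    by (simp add: h_def star_scaleC star_mult star_star)
  have norm_h: "norm h = 1"
    using c(1) by (simp add: h_def norm_scaleC cstar_identity norm_inverse norm_power)
  have \<psi>_h: "\<psi> (to_unitization h) = 1"
    using c by (simp add: h_def to_unitization_simps(2) scaleC)
  define v where "v = 1 - to_unitization h"
  have "v\<^sup>\<star> * v = 1 - to_unitization h - to_unitization h + to_unitization (h * h)"
    by (simp add: v_def star_diff to_unitization_simps flip: to_unitization_simps(4)) (simp add: h algebra_simps)
  then have "\<psi> (v\<^sup>\<star> * v) = \<psi> (to_unitization (h * h)) - 1"
    by (simp add: add diff one \<psi>_h)
  moreover have "Re (\<psi> (to_unitization (h * h))) \<le> 1"
    using complex_Re_le_cmod[of "\<psi> (to_unitization (h * h))"] le[of "to_unitization (h * h)"]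
    by (simp add: norm_hermitian_square[OF h] norm_h)
  ultimately have "(form.snorm v)\<^sup>2 \<le> 0"
    by (simp add: form.snorm_power2)
  then have v: "form.snorm v = 0"
    by simp
  have "\<psi> (u\<^sup>\<star> * v) = 0" "\<psi> (v\<^sup>\<star> * u) = 0" for u
    using form.Cauchy_Schwarz[of u v] form.Cauchy_Schwarz[of v u] by (simp_all add: v)
  from this(1)[of "(to_unitization x)\<^sup>\<star>" for x] this(2)[of "to_unitization x" for x]
  have "\<psi> (to_unitization x * to_unitization h) = \<psi> (to_unitization x)" "\<psi> ((to_unitization h)\<^sup>\<star> * to_unitization x) = \<psi> (to_unitization x)" for x
    by (simp_all add: v_def star_star star_diff right_diff_distrib left_diff_distrib diff)
  with \<psi>_h show ?thesis
    by (intro that[of h]) (simp_all add: to_unitization_simps)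
qed

theorem corollary4p4:
  fixes a b :: "'a::cstar_algebra"
  assumes nonzero: "\<exists>x::'a. x \<noteq> 0"
  shows "(norm_parallel a b \<longleftrightarrow>
            (\<exists>\<phi> \<alpha>. state \<phi> \<and> cmod \<alpha> = 1 \<and> \<phi> (a\<^sup>\<star> * b) = \<alpha> * of_real (norm a * norm b)))
       \<and> (norm_parallel a b \<longleftrightarrow>
            (\<exists>H :: ('a \<Rightarrow> complex) hilbert. hilbert_space H \<and> parallel_in_representation H a b))
       \<and> ((\<exists>H :: 'h hilbert. hilbert_space H \<and> parallel_in_representation H a b) \<longrightarrow>
            norm_parallel a b)"
proof -
  have "(\<exists>\<phi> \<alpha>. state \<phi> \<and> cmod \<alpha> = 1 \<and> \<phi> (a\<^sup>\<star> * b) = \<alpha> * of_real (norm a * norm b)) \<and>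
      (\<exists>H :: ('a \<Rightarrow> complex) hilbert. hilbert_space H \<and> parallel_in_representation H a b)"
    if parallel: "norm_parallel a b"
  proof -
    obtain \<psi> and c :: 'a and \<alpha> where \<psi>: "positive_functional \<psi>" "\<And>u. cmod (\<psi> u) \<le> norm u" "\<psi> 1 = 1"
      and c: "c \<noteq> 0" "\<psi> (to_unitization (c\<^sup>\<star> * c)) = of_real ((norm c)\<^sup>2)"
      and a: "\<psi> (to_unitization (a\<^sup>\<star> * a)) = of_real ((norm a)\<^sup>2)"
      and \<alpha>: "cmod \<alpha> = 1" "\<psi> (to_unitization (a\<^sup>\<star> * b)) = \<alpha> * of_real (norm a * norm b)"
      by (rule exists_extremal_functional[OF parallel nonzero]) blast
    obtain h where h: "\<psi> (to_unitization h) = 1" "\<And>x. \<psi> (to_unitization (h\<^sup>\<star> * x)) = \<psi> (to_unitization x)"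
      "\<And>x. \<psi> (to_unitization (x * h)) = \<psi> (to_unitization x)"
      by (rule exists_unit_mod_kernel[OF \<psi> c]) blast
    interpret positive_functional "\<lambda>x. \<psi> (to_unitization x)"
      by (rule positive_functional_to_unitization[OF \<psi>(1)])
    have vector_state: "cinner form.completion (gns x (form.\<iota> h)) (gns y (form.\<iota> h))
        = \<psi> (to_unitization (x\<^sup>\<star> * y))" for x y
      by (simp add: gns_\<iota> form.cinner_\<iota> star_mult mult.assoc h(2)) (simp add: h(3) flip: mult.assoc)
    have "parallel_in_representation form.completion a b"
      unfolding parallel_in_representation_def
    proof (intro exI conjI)
      show "representation form.completion gns"
        by (rule representation_gns)
      show "form.\<iota> h \<in> carrier form.completion"
        by (rule form.\<iota>_in_carrier)
      show "hnorm form.completion (form.\<iota> h) = 1"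
        by (simp add: hnorm_def form.cinner_\<iota> h(1,2))
      show "hnorm form.completion (gns a (form.\<iota> h)) = norm a"
        by (simp add: hnorm_def vector_state a)
      show "cmod \<alpha> = 1"
        by (rule \<alpha>(1))
      show "cinner form.completion (gns a (form.\<iota> h)) (gns b (form.\<iota> h))
          = \<alpha> * of_real (norm a * norm b)"
        unfolding vector_state by (rule \<alpha>(2))
    qed
    with form.hilbert_space_completion state_to_unitization[OF \<psi>(1,2) c] \<alpha> show ?thesis
      by blast
  qed
  moreover have "norm_parallel a b"
    if "hilbert_space H" "parallel_in_representation H a b" for H :: "'k hilbert"
    using that by (rule hilbert_space.norm_parallel_if_representation)
  ultimately show ?thesis
    using norm_parallel_if_state hilbert_space.norm_parallel_if_representation by metis
qed

end
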